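(* Let $I\subseteq\mathbb{R}$ be a nonempty interval and let $X$, $\Sigma$, $A_n$, $m_n$, $V=\bigoplus_{n\ge 0}V_n$, $\Pi=\prod_{t\in I}X_t$, $H_*:V\to\mathbb{R}^{\Pi}$ and $h_*:V\to\mathbb{R}$ be as in the context. Let $i_*: H_*(V)\to\mathbb{R}$ be a linear map such that $i_*\circ H_*=h_*$, and let $F:C(\Pi)\to\mathbb{R}$ be a linear and continuous (for the uniform metric) extension of $i_*$. Then $F$ has a unique representation as a finite regular Borel measure on $\Pi$: there is a unique finite regular (nonnegative) Borel measure $m$ on $\Pi$ such that $$F(c)=\int_{\Pi}c\,dm\qquad\text{for all } c\in C(\Pi).$$
   Context: Setting. Let $X_0$ be a nonempty locally compact normal Hausdorff space. Put $X=X_0$ if $X_0$ is compact, and otherwise let $X$ be the (Hausdorff) one-point compactification of $X_0$. Let $\Sigma$ be a $\sigma$-algebra on $X$ such that for every $n$ the continuous functions on $X^n$ are measurable with respect to the product $\sigma$-algebra $\bigotimes^n\Sigma$. Let $A_n$ be the real algebra of bounded continuous real functions on $X^n$ ($A_0=\mathbb{R}$). Paths. $X_t=X$ for each $t\in I$; $\Pi=\prod_{t\in I}X_t$ has the product topology; $p_t:\Pi\to X_t$ are the projections; $C(\Pi)$ is the space of continuous real-valued functions on $\Pi$ with the uniform metric. The space $V$. For $n\ge 0$ let $M_n$ be the free real vector space on the set $I^n\times A_n$, let $N_n\subseteq M_n$ be the subspace spanned by all elements $(t,a+rb)-(t,a)-r(t,b)$ with $r\in\mathbb{R}$, $t\in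 I^n$, $a,b\in A_n$, and put $V_n=M_n/N_n$, $V=\bigoplus_{n\ge0}V_n$. Write $[t,a]$ for the class of $(t,a)$. The map $H_*$. $H_*:V\to\mathbb{R}^{\Pi}$ is the linear map determined by $H_*[(t_1,\dots,t_n),a](\pi)=a(p_{t_1}(\pi),\dots,p_{t_n}(\pi))$ for $\pi\in\Pi$. Its values are continuous functions on $\Pi$, so $H_*(V)\subseteq C(\Pi)$. The map $h_*$. For each $n$ let $m_n$ be a function assigning to every $n$-element subset of $I$ a finite nonnegative measure on $(X^n,\bigotimes^n\Sigma)$. For $t_1,\dots,t_n\in I$ let $\#$ be the number of elements of $\{t_1,\dots,t_n\}$, write $\{t_1,\dots,t_n\}=\{u_1<\dots<u_{\#}\}$, and let $\phi:\{1,\dots,n\}\to\{1,\dots,\#\}$ be the function with $t_i=u_{\phi(i)}$. Then $h_*:V\to\mathbb{R}$ is the linear map determined by $$h_*[(t_1,\dots,t_n),a]=\int_{X^{\#}}a(x_{\phi(1)},\dots,x_{\phi(n)})\,dm_{\#}(\{t_1,\dots,t_n\}).$$ *)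

theory Defs
  imports "HOL-Analysis.Analysis" "HOL-Library.Poly_Mapping"
begin

instantiation poly_mapping :: (type, real_vector) real_vector
begin

lift_definition scaleR_poly_mapping :: "real \<Rightarrow> ('a \<Rightarrow>\<^sub>0 'b) \<Rightarrow> 'a \<Rightarrow>\<^sub>0 'b"
  is "\<lambda>r f k. r *\<^sub>R f k"
  by (erule finite_subset[rotated]) auto

instance
  by standard (transfer; auto simp: scaleR_add_right scaleR_add_left)+

end

(* The n-th power of a set or space consists of the functions that are undefined outside {..<n};
   coordinates are numbered from 0. For n = 0 it is a singleton, so alg X 0 is a copy of the reals. *)

definition power_top :: "'b topology \<Rightarrow> nat \<Rightarrow> (nat \<Rightarrow> 'b) topology" where
  "power_top X n = product_topology (\<lambda>_. X) {..<n}"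

definition power_sigma :: "'b topology \<Rightarrow> 'b set set \<Rightarrow> nat \<Rightarrow> (nat \<Rightarrow> 'b) measure" where
  "power_sigma X \<Sigma> n = Pi\<^sub>M {..<n} (\<lambda>_. sigma (topspace X) \<Sigma>)"

(* cfunspace consists of the bounded continuous maps with the supremum metric. *)

definition alg :: "'b topology \<Rightarrow> nat \<Rightarrow> ((nat \<Rightarrow> 'b) \<Rightarrow> real) set" where
  "alg X n = mspace (cfunspace (power_top X n) euclidean_metric)"

definition path_space :: "real set \<Rightarrow> 'b topology \<Rightarrow> (real \<Rightarrow> 'b) topology" where
  "path_space I X = product_topology (\<lambda>_. X) I"

(* The path space is compact whenever X is, so boundedness is no restriction there. *)

definition cont_funs :: "'c topology \<Rightarrow> ('c \<Rightarrow> real) metric" where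
  "cont_funs T = cfunspace T euclidean_metric"

type_synonym 'b generator = "(nat \<Rightarrow> real) \<times> ((nat \<Rightarrow> 'b) \<Rightarrow> real)"

definition free_M :: "real set \<Rightarrow> 'b topology \<Rightarrow> nat \<Rightarrow> ('b generator \<Rightarrow>\<^sub>0 real) set" where
  "free_M I X n = {x. Poly_Mapping.keys x \<subseteq> ({..<n} \<rightarrow>\<^sub>E I) \<times> alg X n}"

definition rel_N :: "real set \<Rightarrow> 'b topology \<Rightarrow> nat \<Rightarrow> ('b generator \<Rightarrow>\<^sub>0 real) set" where
  "rel_N I X n = span
     {Poly_Mapping.single (t, \<lambda>x\<in>topspace (power_top X n). a x + r * b x) 1
        - Poly_Mapping.single (t, a) 1 - r *\<^sub>R Poly_Mapping.single (t, b) 1 | r t a b.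
      t \<in> {..<n} \<rightarrow>\<^sub>E I \<and> a \<in> alg X n \<and> b \<in> alg X n}"

definition coset_N ::
  "real set \<Rightarrow> 'b topology \<Rightarrow> nat \<Rightarrow> ('b generator \<Rightarrow>\<^sub>0 real) \<Rightarrow> ('b generator \<Rightarrow>\<^sub>0 real) set" where
  "coset_N I X n x = (+) x ` rel_N I X n"

definition quot_V :: "real set \<Rightarrow> 'b topology \<Rightarrow> nat \<Rightarrow> ('b generator \<Rightarrow>\<^sub>0 real) set set" where
  "quot_V I X n = coset_N I X n ` free_M I X n"

(* The zero of quot_V I X n is the coset rel_N I X n. *)

definition sum_V :: "real set \<Rightarrow> 'b topology \<Rightarrow> (nat \<Rightarrow> ('b generator \<Rightarrow>\<^sub>0 real) set) set" where
  "sum_V I X = {v. (\<forall>n. v n \<in> quot_V I X n) \<and> finite {n. v n \<noteq> rel_N I X n}}"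

definition V_add ::
  "(nat \<Rightarrow> ('b generator \<Rightarrow>\<^sub>0 real) set) \<Rightarrow> (nat \<Rightarrow> ('b generator \<Rightarrow>\<^sub>0 real) set) \<Rightarrow>
   nat \<Rightarrow> ('b generator \<Rightarrow>\<^sub>0 real) set" where
  "V_add u v = (\<lambda>n. {x + y | x y. x \<in> u n \<and> y \<in> v n})"

(* Adding rel_N matters only for r = 0. *)

definition V_scale ::
  "real set \<Rightarrow> 'b topology \<Rightarrow> real \<Rightarrow> (nat \<Rightarrow> ('b generator \<Rightarrow>\<^sub>0 real) set) \<Rightarrow>
   nat \<Rightarrow> ('b generator \<Rightarrow>\<^sub>0 real) set" where
  "V_scale I X r v = (\<lambda>n. {r *\<^sub>R x + y | x y. x \<in> v n \<and> y \<in> rel_N I X n})"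

definition V_class ::
  "real set \<Rightarrow> 'b topology \<Rightarrow> nat \<Rightarrow> (nat \<Rightarrow> real) \<Rightarrow> ((nat \<Rightarrow> 'b) \<Rightarrow> real) \<Rightarrow>
   nat \<Rightarrow> ('b generator \<Rightarrow>\<^sub>0 real) set" where
  "V_class I X n t a =
     (\<lambda>k. if k = n then coset_N I X n (Poly_Mapping.single (t, a) 1) else rel_N I X k)"

definition free_ext :: "('g \<Rightarrow> real) \<Rightarrow> ('g \<Rightarrow>\<^sub>0 real) \<Rightarrow> real" where
  "free_ext g x = (\<Sum>k\<in>Poly_Mapping.keys x. Poly_Mapping.lookup x k * g k)"

(* The linear map on sum_V with given values g n t a on the classes of (t, a), for g n t linear
   in a: then free_ext is constant on each coset. See V_lift_class, V_lift_add, V_lift_scale. *)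

definition V_lift ::
  "real set \<Rightarrow> 'b topology \<Rightarrow> (nat \<Rightarrow> (nat \<Rightarrow> real) \<Rightarrow> ((nat \<Rightarrow> 'b) \<Rightarrow> real) \<Rightarrow> real) \<Rightarrow>
   (nat \<Rightarrow> ('b generator \<Rightarrow>\<^sub>0 real) set) \<Rightarrow> real" where
  "V_lift I X g v =
     (\<Sum>n | v n \<noteq> rel_N I X n. the_elem (free_ext (\<lambda>(t, a). g n t a) ` v n))"

definition H_star ::
  "real set \<Rightarrow> 'b topology \<Rightarrow> (nat \<Rightarrow> ('b generator \<Rightarrow>\<^sub>0 real) set) \<Rightarrow> (real \<Rightarrow> 'b) \<Rightarrow> real" where
  "H_star I X v = (\<lambda>\<pi>\<in>topspace (path_space I X).
     V_lift I X (\<lambda>n t a. a (\<lambda>i\<in>{..<n}. \<pi> (t i))) v)"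

(* For S = {u_0 < ... < u_(k-1)}, rank_in S (u_j) = j. *)

definition rank_in :: "real set \<Rightarrow> real \<Rightarrow> nat" where
  "rank_in S s = (THE j. j < card S \<and> sorted_list_of_set S ! j = s)"

definition h_star ::
  "real set \<Rightarrow> 'b topology \<Rightarrow> (nat \<Rightarrow> real set \<Rightarrow> (nat \<Rightarrow> 'b) measure) \<Rightarrow>
   (nat \<Rightarrow> ('b generator \<Rightarrow>\<^sub>0 real) set) \<Rightarrow> real" where
  "h_star I X m = V_lift I X (\<lambda>n t a. let S = t ` {..<n} in
     \<integral>x. a (\<lambda>i\<in>{..<n}. x (rank_in S (t i))) \<partial>m (card S) S)"

definition linear_functional_on :: "'c set \<Rightarrow> ('c \<Rightarrow> real) set \<Rightarrow> (('c \<Rightarrow> real) \<Rightarrow> real) \<Rightarrow> bool" where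
  "linear_functional_on S U F \<longleftrightarrow>
     (\<forall>f\<in>U. \<forall>g\<in>U. F (\<lambda>x\<in>S. f x + g x) = F f + F g) \<and>
     (\<forall>r. \<forall>f\<in>U. F (\<lambda>x\<in>S. r * f x) = r * F f)"

definition finite_regular_borel_measure :: "'c topology \<Rightarrow> 'c measure \<Rightarrow> bool" where
  "finite_regular_borel_measure T \<mu> \<longleftrightarrow>
     space \<mu> = topspace T \<and>
     sets \<mu> = sigma_sets (topspace T) {U. openin T U} \<and>
     finite_measure \<mu> \<and>
     (\<forall>B\<in>sets \<mu>. emeasure \<mu> B = (INF U\<in>{U. openin T U \<and> B \<subseteq> U}. emeasure \<mu> U)) \<and>
     (\<forall>B\<in>sets \<mu>. emeasure \<mu> B = (SUP K\<in>{K. compactin T K \<and> K \<in> sets \<mu> \<and> K \<subseteq> B}. emeasure \<mu> K))"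


lemma free_ext_superset:
  assumes "finite K" "Poly_Mapping.keys x \<subseteq> K"
  shows "free_ext g x = (\<Sum>k\<in>K. Poly_Mapping.lookup x k * g k)"
  unfolding free_ext_def using assms
  by (intro sum.mono_neutral_left) (auto simp: in_keys_iff)

lemma lookup_scaleR [simp]: "Poly_Mapping.lookup (r *\<^sub>R x) k = r *\<^sub>R Poly_Mapping.lookup x k"
  by transfer simp

lemma linear_free_ext: "linear (free_ext g)"
proof
  fix x y :: "'a \<Rightarrow>\<^sub>0 real" and r :: real
  let ?K = "Poly_Mapping.keys x \<union> Poly_Mapping.keys y"
  have "Poly_Mapping.keys (x + y) \<subseteq> ?K"
    by (rule keys_add)
  then show "free_ext g (x + y) = free_ext g x + free_ext g y"
    by (simp add: free_ext_superset[of ?K] lookup_add distrib_right sum.distrib)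
  have "Poly_Mapping.keys (r *\<^sub>R x) \<subseteq> Poly_Mapping.keys x"
    by (auto simp: in_keys_iff)
  then show "free_ext g (r *\<^sub>R x) = r *\<^sub>R free_ext g x"
    by (simp add: free_ext_superset[of "Poly_Mapping.keys x"] sum_distrib_left mult.assoc)
qed

lemma free_ext_single [simp]: "free_ext g (Poly_Mapping.single k 1) = g k"
  by (simp add: free_ext_def)

definition lin_gen :: "real set \<Rightarrow> 'b topology \<Rightarrow>
    (nat \<Rightarrow> (nat \<Rightarrow> real) \<Rightarrow> ((nat \<Rightarrow> 'b) \<Rightarrow> real) \<Rightarrow> real) \<Rightarrow> bool" where
  "lin_gen I X g \<longleftrightarrow> (\<forall>n. \<forall>t\<in>{..<n} \<rightarrow>\<^sub>E I. \<forall>a\<in>alg X n. \<forall>b\<in>alg X n. \<forall>r.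
     g n t (\<lambda>x\<in>topspace (power_top X n). a x + r * b x) = g n t a + r * g n t b)"

lemma free_ext_rel_N:
  assumes "lin_gen I X g" "x \<in> rel_N I X n"
  shows "free_ext (\<lambda>(t, a). g n t a) x = 0"
proof -
  interpret L: linear "free_ext (\<lambda>(t, a). g n t a)"
    by (rule linear_free_ext)
  from assms(2) show ?thesis
    unfolding rel_N_def
  proof (induction rule: span_induct)
    case base
    show ?case
      by (auto simp: subspace_def L.zero L.add L.scaleR)
  next
    case (step y)
    then show ?case
      using assms(1) by (auto simp: L.diff L.scaleR lin_gen_def)
  qed
qed

lemma subspace_rel_N: "subspace (rel_N I X n)"
  by (simp add: rel_N_def)

lemma mem_coset_N: "x \<in> coset_N I X n x"
  using subspace_0[OF subspace_rel_N] by (force simp: coset_N_def)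

lemma coset_N_zero: "coset_N I X n 0 = rel_N I X n"
  by (simp add: coset_N_def)

lemma coset_N_eq:
  assumes "x \<in> rel_N I X n"
  shows "coset_N I X n x = rel_N I X n"
proof -
  have "y \<in> (+) x ` rel_N I X n" if "y \<in> rel_N I X n" for y
    using subspace_diff[OF subspace_rel_N that assms] by (rule rev_image_eqI) simp
  then show ?thesis
    using subspace_add[OF subspace_rel_N assms] by (auto simp: coset_N_def)
qed

lemma the_elem_coset_N:
  assumes "lin_gen I X g"
  shows "the_elem (free_ext (\<lambda>(t, a). g n t a) ` coset_N I X n x) = free_ext (\<lambda>(t, a). g n t a) x"
proof -
  interpret L: linear "free_ext (\<lambda>(t, a). g n t a)"
    by (rule linear_free_ext)
  have "free_ext (\<lambda>(t, a). g n t a) ` coset_N I X n x = {free_ext (\<lambda>(t, a). g n t a) x}"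
    using mem_coset_N[of x I X n] free_ext_rel_N[OF assms]
    by (auto simp: coset_N_def L.add image_iff)
  then show ?thesis by simp
qed

lemma V_lift_superset:
  assumes g: "lin_gen I X g" and K: "finite K" "{n. v n \<noteq> rel_N I X n} \<subseteq> K"
    and v: "\<And>n. v n = coset_N I X n (x n)"
  shows "V_lift I X g v = (\<Sum>n\<in>K. free_ext (\<lambda>(t, a). g n t a) (x n))"
proof -
  have "V_lift I X g v = (\<Sum>n | v n \<noteq> rel_N I X n. free_ext (\<lambda>(t, a). g n t a) (x n))"
    unfolding V_lift_def by (rule sum.cong) (simp_all add: v the_elem_coset_N[OF g])
  also have "\<dots> = (\<Sum>n\<in>K. free_ext (\<lambda>(t, a). g n t a) (x n))"
  proof (rule sum.mono_neutral_left[OF K], intro ballI)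
    fix n assume "n \<in> K - {n. v n \<noteq> rel_N I X n}"
    then have "x n \<in> rel_N I X n"
      using mem_coset_N[of "x n" I X n] v[of n] by simp
    then show "free_ext (\<lambda>(t, a). g n t a) (x n) = 0"
      by (rule free_ext_rel_N[OF g])
  qed
  finally show ?thesis .
qed

lemma sum_V_rep:
  assumes "v \<in> sum_V I X"
  shows "\<exists>x. \<forall>n. v n = coset_N I X n (x n)"
proof -
  have "\<forall>n. \<exists>x. v n = coset_N I X n x"
    using assms by (auto simp: sum_V_def quot_V_def)
  then show ?thesis by (rule choice)
qed

lemma V_add_coset:
  assumes "\<And>n. u n = coset_N I X n (x n)" "\<And>n. v n = coset_N I X n (y n)"
  shows "V_add u v n = coset_N I X n (x n + y n)"
proof
  show "V_add u v n \<subseteq> coset_N I X n (x n + y n)"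
  proof
    fix p assume "p \<in> V_add u v n"
    then obtain z w where zw: "z \<in> rel_N I X n" "w \<in> rel_N I X n" "p = (x n + z) + (y n + w)"
      by (auto simp: V_add_def assms coset_N_def)
    then have "p = (x n + y n) + (z + w)" "z + w \<in> rel_N I X n"
      by (simp_all add: algebra_simps subspace_add[OF subspace_rel_N])
    then show "p \<in> coset_N I X n (x n + y n)"
      by (simp add: coset_N_def)
  qed
  show "coset_N I X n (x n + y n) \<subseteq> V_add u v n"
  proof
    fix p assume "p \<in> coset_N I X n (x n + y n)"
    then obtain w where "w \<in> rel_N I X n" "p = x n + (y n + w)"
      by (auto simp: coset_N_def add.assoc)
    moreover have "x n \<in> u n"
      by (simp add: assms mem_coset_N)
    ultimately show "p \<in> V_add u v n"
      unfolding V_add_def by (auto simp: assms(2) coset_N_def)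
  qed
qed

lemma V_scale_coset:
  assumes "\<And>n. v n = coset_N I X n (x n)"
  shows "V_scale I X r v n = coset_N I X n (r *\<^sub>R x n)"
proof
  show "V_scale I X r v n \<subseteq> coset_N I X n (r *\<^sub>R x n)"
  proof
    fix p assume "p \<in> V_scale I X r v n"
    then obtain z w where zw: "z \<in> rel_N I X n" "w \<in> rel_N I X n" "p = r *\<^sub>R (x n + z) + w"
      by (auto simp: V_scale_def assms coset_N_def)
    then have "p = r *\<^sub>R x n + (r *\<^sub>R z + w)" "r *\<^sub>R z + w \<in> rel_N I X n"
      by (simp_all add: algebra_simps subspace_add[OF subspace_rel_N]
          subspace_scale[OF subspace_rel_N])
    then show "p \<in> coset_N I X n (r *\<^sub>R x n)"
      by (simp add: coset_N_def)
  qed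
  show "coset_N I X n (r *\<^sub>R x n) \<subseteq> V_scale I X r v n"
  proof
    fix p assume "p \<in> coset_N I X n (r *\<^sub>R x n)"
    then obtain w where "w \<in> rel_N I X n" "p = r *\<^sub>R x n + w"
      by (auto simp: coset_N_def)
    moreover have "x n \<in> v n"
      by (simp add: assms mem_coset_N)
    ultimately show "p \<in> V_scale I X r v n"
      unfolding V_scale_def by blast
  qed
qed

lemma V_lift_add:
  assumes g: "lin_gen I X g" and u: "u \<in> sum_V I X" and v: "v \<in> sum_V I X"
  shows "V_lift I X g (V_add u v) = V_lift I X g u + V_lift I X g v"
proof -
  obtain x where x: "\<And>n. u n = coset_N I X n (x n)" using sum_V_rep[OF u] by blast
  obtain y where y: "\<And>n. v n = coset_N I X n (y n)" using sum_V_rep[OF v] by blast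
  let ?K = "{n. u n \<noteq> rel_N I X n} \<union> {n. v n \<noteq> rel_N I X n}"
  have K: "finite ?K" using u v by (simp add: sum_V_def)
  have "V_add u v n = rel_N I X n" if "u n = rel_N I X n" "v n = rel_N I X n" for n
  proof -
    have "x n \<in> rel_N I X n" "y n \<in> rel_N I X n"
      using that x[of n] y[of n] mem_coset_N by metis+
    then have "x n + y n \<in> rel_N I X n"
      by (rule subspace_add[OF subspace_rel_N])
    then show ?thesis
      using V_add_coset[OF x y] by (simp add: coset_N_eq)
  qed
  then have sub: "{n. V_add u v n \<noteq> rel_N I X n} \<subseteq> ?K" by blast
  interpret L: linear "free_ext (\<lambda>(t, a). g n t a)" for n
    by (rule linear_free_ext)
  show ?thesis
    using V_lift_superset[OF g K sub V_add_coset[OF x y]]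
      V_lift_superset[OF g K _ x] V_lift_superset[OF g K _ y]
    by (simp add: L.add sum.distrib)
qed

lemma V_lift_scale:
  assumes g: "lin_gen I X g" and v: "v \<in> sum_V I X"
  shows "V_lift I X g (V_scale I X r v) = r * V_lift I X g v"
proof -
  obtain x where x: "\<And>n. v n = coset_N I X n (x n)" using sum_V_rep[OF v] by blast
  let ?K = "{n. v n \<noteq> rel_N I X n}"
  have K: "finite ?K" using v by (simp add: sum_V_def)
  have "V_scale I X r v n = rel_N I X n" if "v n = rel_N I X n" for n
  proof -
    have "x n \<in> rel_N I X n"
      using that x[of n] mem_coset_N by metis
    then have "r *\<^sub>R x n \<in> rel_N I X n"
      by (rule subspace_scale[OF subspace_rel_N])
    then show ?thesis
      using V_scale_coset[OF x] by (simp add: coset_N_eq)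
  qed
  then have sub: "{n. V_scale I X r v n \<noteq> rel_N I X n} \<subseteq> ?K" by blast
  interpret L: linear "free_ext (\<lambda>(t, a). g n t a)" for n
    by (rule linear_free_ext)
  show ?thesis
    using V_lift_superset[OF g K sub V_scale_coset[OF x]] V_lift_superset[OF g K _ x]
    by (simp add: L.scaleR sum_distrib_left)
qed

lemma V_class_in_sum_V:
  assumes "t \<in> {..<n} \<rightarrow>\<^sub>E I" "a \<in> alg X n"
  shows "V_class I X n t a \<in> sum_V I X"
proof -
  have "rel_N I X k \<in> quot_V I X k" for k
    unfolding quot_V_def by (rule image_eqI[of _ _ 0]) (auto simp: coset_N_zero free_M_def)
  moreover have "coset_N I X n (Poly_Mapping.single (t, a) 1) \<in> quot_V I X n"
    using assms by (auto simp: quot_V_def free_M_def)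
  moreover have "finite {k. V_class I X n t a k \<noteq> rel_N I X k}"
    by (rule finite_subset[of _ "{n}"]) (auto simp: V_class_def)
  ultimately show ?thesis
    by (auto simp: sum_V_def V_class_def)
qed

lemma V_lift_class:
  assumes g: "lin_gen I X g" and "t \<in> {..<n} \<rightarrow>\<^sub>E I" "a \<in> alg X n"
  shows "V_lift I X g (V_class I X n t a) = g n t a"
proof -
  have "V_class I X n t a k =
      coset_N I X k (if k = n then Poly_Mapping.single (t, a) 1 else 0)" for k
    by (simp add: V_class_def coset_N_zero)
  moreover have "{k. V_class I X n t a k \<noteq> rel_N I X k} \<subseteq> {n}"
    by (auto simp: V_class_def)
  ultimately show ?thesis
    using V_lift_superset[OF g, of "{n}" "V_class I X n t a"] by simp
qed

lemma topspace_power_top: "topspace (power_top X n) = {..<n} \<rightarrow>\<^sub>E topspace X"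
  by (simp add: power_top_def)

lemma lin_gen_H_star:
  assumes "\<pi> \<in> topspace (path_space I X)"
  shows "lin_gen I X (\<lambda>n t a. a (\<lambda>i\<in>{..<n}. \<pi> (t i)))"
proof -
  have "(\<lambda>i\<in>{..<n}. \<pi> (t i)) \<in> topspace (power_top X n)" if "t \<in> {..<n} \<rightarrow>\<^sub>E I" for n t
    using that assms by (auto simp: topspace_power_top path_space_def)
  then show ?thesis
    by (simp add: lin_gen_def)
qed

lemma H_star_class:
  assumes "t \<in> {..<n} \<rightarrow>\<^sub>E I" "a \<in> alg X n" "\<pi> \<in> topspace (path_space I X)"
  shows "H_star I X (V_class I X n t a) \<pi> = a (\<lambda>i\<in>{..<n}. \<pi> (t i))"
  using assms by (simp add: H_star_def V_lift_class[OF lin_gen_H_star])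

lemma H_star_add:
  assumes "u \<in> sum_V I X" "v \<in> sum_V I X"
  shows "H_star I X (V_add u v) =
    (\<lambda>\<pi>\<in>topspace (path_space I X). H_star I X u \<pi> + H_star I X v \<pi>)"
  using assms by (auto simp: H_star_def V_lift_add[OF lin_gen_H_star] intro!: restrict_ext)

lemma H_star_scale:
  assumes "v \<in> sum_V I X"
  shows "H_star I X (V_scale I X r v) = (\<lambda>\<pi>\<in>topspace (path_space I X). r * H_star I X v \<pi>)"
  using assms by (auto simp: H_star_def V_lift_scale[OF lin_gen_H_star] intro!: restrict_ext)

lemma H_star_in_cont_funs:
  assumes X: "compact_space X" and v: "v \<in> sum_V I X"
  shows "H_star I X v \<in> mspace (cont_funs (path_space I X))"
proof -
  let ?P = "path_space I X"
  have "\<forall>n. \<exists>x. x \<in> free_M I X n \<and> v n = coset_N I X n x"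
    using v by (auto simp: sum_V_def quot_V_def)
  then obtain x where x: "\<And>n. x n \<in> free_M I X n" "\<And>n. v n = coset_N I X n (x n)"
    by metis
  let ?K = "{n. v n \<noteq> rel_N I X n}"
  have K: "finite ?K" using v by (simp add: sum_V_def)
  let ?G = "\<lambda>\<pi>. \<Sum>n\<in>?K. \<Sum>k\<in>Poly_Mapping.keys (x n).
    Poly_Mapping.lookup (x n) k * (snd k) (\<lambda>i\<in>{..<n}. \<pi> (fst k i))"
  have eq: "H_star I X v \<pi> = ?G \<pi>" if "\<pi> \<in> topspace ?P" for \<pi>
    using that V_lift_superset[OF lin_gen_H_star[OF that] K subset_refl x(2)]
    by (simp add: H_star_def free_ext_def case_prod_unfold)
  have "continuous_map ?P euclideanreal ?G"
  proof (intro continuous_map_sum K finite_keys continuous_map_real_mult_left)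
    fix n k assume "k \<in> Poly_Mapping.keys (x n)"
    then have "k \<in> ({..<n} \<rightarrow>\<^sub>E I) \<times> alg X n"
      using x(1)[of n] unfolding free_M_def by blast
    then have t: "fst k \<in> {..<n} \<rightarrow>\<^sub>E I" and a: "snd k \<in> alg X n"
      by (simp_all add: mem_Times_iff)
    have "continuous_map ?P (power_top X n) (\<lambda>\<pi>. \<lambda>i\<in>{..<n}. \<pi> (fst k i))"
      unfolding power_top_def path_space_def using t
      by (subst continuous_map_componentwise)
         (auto intro!: continuous_map_product_projection)
    moreover have "continuous_map (power_top X n) euclideanreal (snd k)"
      using a by (auto simp: alg_def)
    ultimately show "continuous_map ?P euclideanreal (\<lambda>\<pi>. snd k (\<lambda>i\<in>{..<n}. \<pi> (fst k i)))"
      using continuous_map_compose by (fastforce simp: comp_def)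
  qed
  then have cont: "continuous_map ?P euclideanreal (H_star I X v)"
    by (rule continuous_map_eq) (simp add: eq)
  have "compact_space ?P"
    using X by (simp add: path_space_def compact_space_product_topology)
  then have "compactin euclideanreal (H_star I X v ` topspace ?P)"
    using cont image_compactin unfolding compact_space_def by blast
  then have "bounded (H_star I X v ` topspace ?P)"
    by (simp add: compact_imp_bounded)
  then show ?thesis
    using cont by (simp add: cont_funs_def H_star_def)
qed

lemma rank_in:
  assumes "finite S" "s \<in> S"
  shows "rank_in S s < card S" "sorted_list_of_set S ! rank_in S s = s"
proof -
  let ?xs = "sorted_list_of_set S"
  have "\<exists>!j. j < length ?xs \<and> ?xs ! j = s"
    by (rule distinct_Ex1) (use assms in auto)
  then have "\<exists>!j. j < card S \<and> ?xs ! j = s"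
    by simp
  from theI'[OF this] show "rank_in S s < card S" "?xs ! rank_in S s = s"
    by (simp_all add: rank_in_def)
qed

locale finite_dim_measures =
  fixes I :: "real set" and X :: "'b topology" and \<Sigma> :: "'b set set"
    and m :: "nat \<Rightarrow> real set \<Rightarrow> (nat \<Rightarrow> 'b) measure"
  assumes sigma: "sigma_algebra (topspace X) \<Sigma>"
    and meas: "\<And>n f. continuous_map (power_top X n) euclideanreal f \<Longrightarrow>
      f \<in> borel_measurable (power_sigma X \<Sigma> n)"
    and m: "\<And>n S. S \<subseteq> I \<Longrightarrow> finite S \<Longrightarrow> card S = n \<Longrightarrow>
      finite_measure (m n S) \<and> sets (m n S) = sets (power_sigma X \<Sigma> n)"
begin

lemma integrable_reindex:
  assumes t: "t \<in> {..<n} \<rightarrow>\<^sub>E I" and a: "a \<in> alg X n" and S: "S = t ` {..<n}"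
  shows "integrable (m (card S) S) (\<lambda>x. a (\<lambda>i\<in>{..<n}. x (rank_in S (t i))))"
proof -
  have fin: "finite S" and SI: "S \<subseteq> I"
    using S t by auto
  have rank: "rank_in S (t i) < card S" if "i < n" for i
    using that by (intro rank_in[OF fin]) (simp add: S)
  let ?M = "m (card S) S"
  interpret finite_measure ?M
    using m[OF SI fin refl] by blast
  have sets: "sets ?M = sets (power_sigma X \<Sigma> (card S))"
    using m[OF SI fin refl] by blast
  have sp: "space ?M = topspace (power_top X (card S))"
    using sets_eq_imp_space_eq[OF sets]
    by (simp add: power_sigma_def space_PiM space_measure_of_conv topspace_power_top)
  have ca: "continuous_map (power_top X n) euclideanreal a"
    and ba: "bounded (a ` topspace (power_top X n))"
    using a by (auto simp: alg_def)
  let ?r = "\<lambda>x. \<lambda>i\<in>{..<n}. x (rank_in S (t i))"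
  have cr: "continuous_map (power_top X (card S)) (power_top X n) ?r"
    unfolding power_top_def
    by (subst continuous_map_componentwise)
       (auto intro!: continuous_map_product_projection rank)
  have "continuous_map (power_top X (card S)) euclideanreal (a \<circ> ?r)"
    by (rule continuous_map_compose[OF cr ca])
  then have "a \<circ> ?r \<in> borel_measurable ?M"
    using meas measurable_cong_sets[OF sets refl] by blast
  moreover obtain B where "\<And>y. y \<in> topspace (power_top X n) \<Longrightarrow> norm (a y) \<le> B"
    using ba by (auto simp: bounded_iff)
  then have "norm ((a \<circ> ?r) x) \<le> B" if "x \<in> space ?M" for x
    using that continuous_map_image_subset_topspace[OF cr] by (auto simp: sp)
  ultimately have "integrable ?M (a \<circ> ?r)"
    by (intro integrable_const_bound[where B = B]) auto
  then show ?thesis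
    by (simp add: comp_def)
qed

lemma lin_gen_h_star:
  "lin_gen I X (\<lambda>n t a. let S = t ` {..<n} in
     \<integral>x. a (\<lambda>i\<in>{..<n}. x (rank_in S (t i))) \<partial>m (card S) S)"
  unfolding lin_gen_def Let_def
proof (intro allI ballI)
  fix n t a b and r :: real
  assume t: "t \<in> {..<n} \<rightarrow>\<^sub>E I" and a: "a \<in> alg X n" and b: "b \<in> alg X n"
  define S where "S = t ` {..<n}"
  have fin: "finite S" and SI: "S \<subseteq> I"
    using S_def t by auto
  let ?M = "m (card S) S"
  let ?r = "\<lambda>x. \<lambda>i\<in>{..<n}. x (rank_in S (t i))"
  have sp: "space ?M = {..<card S} \<rightarrow>\<^sub>E topspace X"
    using m[OF SI fin refl] sets_eq_imp_space_eq[of ?M "power_sigma X \<Sigma> (card S)"]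
    by (simp add: power_sigma_def space_PiM space_measure_of_conv)
  have rank: "rank_in S (t i) < card S" if "i < n" for i
    using that by (intro rank_in(1)[OF fin]) (simp add: S_def)
  have "?r x \<in> topspace (power_top X n)" if x: "x \<in> {..<card S} \<rightarrow>\<^sub>E topspace X" for x
  proof -
    have "x (rank_in S (t i)) \<in> topspace X" if "i < n" for i
      using PiE_mem[OF x] rank[OF that] by simp
    then show ?thesis
      by (simp add: topspace_power_top)
  qed
  then have "?r x \<in> topspace (power_top X n)" if "x \<in> space ?M" for x
    using that unfolding sp .
  then have "(\<integral>x. (\<lambda>x\<in>topspace (power_top X n). a x + r * b x) (?r x) \<partial>?M)
      = (\<integral>x. a (?r x) + r * b (?r x) \<partial>?M)"
    by (intro Bochner_Integration.integral_cong) auto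
  also have "\<dots> = (\<integral>x. a (?r x) \<partial>?M) + r * (\<integral>x. b (?r x) \<partial>?M)"
    using integrable_reindex[OF t a S_def] integrable_reindex[OF t b S_def] by simp
  finally show "(\<integral>x. (\<lambda>x\<in>topspace (power_top X n). a x + r * b x)
        (\<lambda>i\<in>{..<n}. x (rank_in (t ` {..<n}) (t i))) \<partial>m (card (t ` {..<n})) (t ` {..<n}))
      = (\<integral>x. a (\<lambda>i\<in>{..<n}. x (rank_in (t ` {..<n}) (t i))) \<partial>m (card (t ` {..<n})) (t ` {..<n}))
      + r * (\<integral>x. b (\<lambda>i\<in>{..<n}. x (rank_in (t ` {..<n}) (t i))) \<partial>m (card (t ` {..<n})) (t ` {..<n}))"
    by (simp add: S_def)
qed

lemma h_star_class:
  assumes "t \<in> {..<n} \<rightarrow>\<^sub>E I" "a \<in> alg X n" "S = t ` {..<n}"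
  shows "h_star I X m (V_class I X n t a) =
    (\<integral>x. a (\<lambda>i\<in>{..<n}. x (rank_in S (t i))) \<partial>m (card S) S)"
  using V_lift_class[OF lin_gen_h_star assms(1,2)] by (simp add: h_star_def assms(3) Let_def)

lemma h_star_add:
  "u \<in> sum_V I X \<Longrightarrow> v \<in> sum_V I X \<Longrightarrow>
   h_star I X m (V_add u v) = h_star I X m u + h_star I X m v"
  unfolding h_star_def by (rule V_lift_add[OF lin_gen_h_star])

lemma h_star_scale:
  "v \<in> sum_V I X \<Longrightarrow> h_star I X m (V_scale I X r v) = r * h_star I X m v"
  unfolding h_star_def by (rule V_lift_scale[OF lin_gen_h_star])

end

end

theory Submission
  imports Defs
begin

text \<open>The functional \<^term>\<open>F\<close> is positive: a continuous function \<open>c \<ge> 0\<close> on the compact product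
  is, up to a uniform error \<open>\<epsilon>\<close>, determined by finitely many coordinates, so freezing the other ones
  yields a cylinder function \<open>H\<^sub>*[t, a]\<close> with \<open>a \<ge> 0\<close>, on which \<^term>\<open>F\<close> is the integral of \<open>a\<close>
  with respect to a nonnegative measure; now let \<open>\<epsilon>\<close> tend to 0. The claim is thus an instance of the
  Riesz representation theorem for compact Hausdorff spaces. There the measure of an open set \<open>U\<close> is
  the supremum of the functional over the continuous functions below the indicator of \<open>U\<close>, the
  induced outer measure is additive along open sets, and Caratheodory's construction applies.\<close>

subsection \<open>Riesz representation on compact Hausdorff spaces\<close>

text \<open>This is the usual relation between a test function and an open set, but without the
  condition that the support lies inside \<open>U\<close>; \<open>cutoff\<close> recovers such a
  condition at a small loss. Openness of \<open>U\<close> is not built in, because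
  \<open>cutoff\<close> applies the notion to closed sets as well.\<close>

definition below_indicator :: "'c topology \<Rightarrow> 'c set \<Rightarrow> ('c \<Rightarrow> real) \<Rightarrow> bool" where
  "below_indicator T U f \<longleftrightarrow> continuous_map T euclideanreal f \<and>
     (\<forall>x\<in>topspace T. 0 \<le> f x \<and> f x \<le> 1 \<and> (x \<notin> U \<longrightarrow> f x = 0))"

lemma below_indicatorI:
  assumes "continuous_map T euclideanreal f"
    and "\<And>x. x \<in> topspace T \<Longrightarrow> 0 \<le> f x" "\<And>x. x \<in> topspace T \<Longrightarrow> f x \<le> 1"
    and "\<And>x. x \<in> topspace T \<Longrightarrow> x \<notin> U \<Longrightarrow> f x = 0"
  shows "below_indicator T U f"
  using assms by (auto simp: below_indicator_def)

lemma below_indicatorD: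
  assumes "below_indicator T U f"
  shows "continuous_map T euclideanreal f"
    and "x \<in> topspace T \<Longrightarrow> 0 \<le> f x" and "x \<in> topspace T \<Longrightarrow> f x \<le> 1"
    and "x \<in> topspace T \<Longrightarrow> x \<notin> U \<Longrightarrow> f x = 0"
  using assms by (auto simp: below_indicator_def)

lemma below_indicator_mono:
  "below_indicator T U f \<Longrightarrow> U \<subseteq> W \<Longrightarrow> below_indicator T W f"
  using below_indicatorD[of T U f] by (intro below_indicatorI) auto

lemma below_indicator_zero: "below_indicator T U (\<lambda>x. 0)"
  by (rule below_indicatorI) auto

lemma borel_measurable_continuous_map:
  assumes "continuous_map T euclideanreal f"
    and "space M = topspace T" "sets M = sigma_sets (topspace T) {U. openin T U}"
  shows "f \<in> borel_measurable M"
proof (rule borel_measurableI_greater)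
  fix y
  have "openin T {x \<in> topspace T. f x \<in> {y<..}}"
    using assms(1) by (rule openin_continuous_map_preimage) auto
  then show "{x \<in> space M. y < f x} \<in> sets M"
    using assms(2,3) by (auto intro: sigma_sets.Basic)
qed

text \<open>The k-th summand is the part of \<open>x\<close> in the slice between
  \<open>k * c\<close> and \<open>(k + 1) * c\<close>. The truncation of \<open>x\<close> at height
  \<open>y\<close> plus its part between \<open>y\<close> and \<open>y + c\<close> is the truncation
  at \<open>y + c\<close>, so the slices add up. This serves the layer-cake estimate of
  \<open>le_integral_add\<close>.\<close>

lemma sum_layers:
  fixes x c :: real
  assumes "0 \<le> c"
  shows "(\<Sum>k<n. min (max (x - real k * c) 0) c) = min (max x 0) (real n * c)"
proof (induction n)
  case 0
  then show ?case by simp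
next
  case (Suc n)
  have "min (max x 0) y + min (max (x - y) 0) c = min (max x 0) (y + c)" if "0 \<le> y" for y
    using that assms by (auto simp: min_def max_def)
  from this[of "real n * c"] Suc show ?case
    using assms by (simp add: algebra_simps)
qed

lemma finite_regular_borel_measureD:
  assumes "finite_regular_borel_measure T \<mu>"
  shows "space \<mu> = topspace T" "sets \<mu> = sigma_sets (topspace T) {U. openin T U}" "finite_measure \<mu>"
  using assms by (auto simp: finite_regular_borel_measure_def)

lemma finite_regular_borel_measure_outer:
  assumes "finite_regular_borel_measure T \<mu>" "B \<in> sets \<mu>"
  shows "emeasure \<mu> B = (INF U\<in>{U. openin T U \<and> B \<subseteq> U}. emeasure \<mu> U)"
  using assms unfolding finite_regular_borel_measure_def by blast

lemma finite_regular_borel_measure_inner: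
  assumes "finite_regular_borel_measure T \<mu>" "B \<in> sets \<mu>"
  shows "emeasure \<mu> B = (SUP K\<in>{K. compactin T K \<and> K \<in> sets \<mu> \<and> K \<subseteq> B}. emeasure \<mu> K)"
  using assms unfolding finite_regular_borel_measure_def by blast

lemma compact_space_continuous_map_bounded:
  assumes "compact_space T" "continuous_map T euclideanreal f"
  obtains B where "0 < B" "\<And>x. x \<in> topspace T \<Longrightarrow> \<bar>f x\<bar> \<le> B"
proof -
  have "compactin euclideanreal (f ` topspace T)"
    using assms image_compactin unfolding compact_space_def by blast
  then have "bounded (f ` topspace T)"
    by (simp add: compact_imp_bounded)
  then show thesis
    using that by (auto simp: bounded_pos)
qed

lemma integrable_continuous_map:
  assumes "compact_space T" "continuous_map T euclideanreal f"
    and \<mu>: "space \<mu> = topspace T" "sets \<mu> = sigma_sets (topspace T) {U. openin T U}" "finite_measure \<mu>"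
  shows "integrable \<mu> f"
proof -
  interpret finite_measure \<mu> by fact
  obtain B where "\<And>x. x \<in> topspace T \<Longrightarrow> \<bar>f x\<bar> \<le> B"
    using compact_space_continuous_map_bounded[OF assms(1,2)] by metis
  then show ?thesis
    using borel_measurable_continuous_map[OF assms(2) \<mu>(1,2)]
    by (intro integrable_const_bound[where B = B]) (auto simp: \<mu>(1))
qed

section \<open>Positive functionals and separation by continuous functions\<close>

text \<open>The functional takes unrestricted functions, so that pointwise operations need no
  \<open>restrict\<close>. Using \<open>mono\<close> in both directions, its value at a continuous
  function depends only on the values on \<open>topspace T\<close>.\<close>

locale positive_functional =
  fixes T :: "'c topology" and L :: "('c \<Rightarrow> real) \<Rightarrow> real"
  assumes compact: "compact_space T" and Hausdorff: "Hausdorff_space T"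
    and add: "\<And>f g. continuous_map T euclideanreal f \<Longrightarrow> continuous_map T euclideanreal g \<Longrightarrow>
      L (\<lambda>x. f x + g x) = L f + L g"
    and scale: "\<And>r f. continuous_map T euclideanreal f \<Longrightarrow> L (\<lambda>x. r * f x) = r * L f"
    and mono: "\<And>f g. continuous_map T euclideanreal f \<Longrightarrow> continuous_map T euclideanreal g \<Longrightarrow>
      (\<And>x. x \<in> topspace T \<Longrightarrow> f x \<le> g x) \<Longrightarrow> L f \<le> L g"
begin

lemma const: "L (\<lambda>x. c) = c * L (\<lambda>x. 1)"
  using scale[of "\<lambda>x. 1" c] by simp

lemma zero: "L (\<lambda>x. 0) = 0"
  using const[of 0] by simp

lemma nonneg:
  "continuous_map T euclideanreal f \<Longrightarrow> (\<And>x. x \<in> topspace T \<Longrightarrow> 0 \<le> f x) \<Longrightarrow> 0 \<le> L f"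
  using mono[of "\<lambda>x. 0" f] zero by simp

lemma sum:
  assumes "finite A" "\<And>i. i \<in> A \<Longrightarrow> continuous_map T euclideanreal (f i)"
  shows "L (\<lambda>x. \<Sum>i\<in>A. f i x) = (\<Sum>i\<in>A. L (f i))"
  using assms
  by (induction A rule: finite_induct) (simp_all add: zero add continuous_map_sum)

lemma Urysohn:
  assumes "closedin T K" "openin T U" "K \<subseteq> U"
  obtains h where "below_indicator T U h" "\<And>x. x \<in> K \<Longrightarrow> h x = 1"
proof -
  have "normal_space T"
    using compact Hausdorff compact_Hausdorff_or_regular_imp_normal_space by blast
  moreover have "closedin T (topspace T - U)" "disjnt (topspace T - U) K"
    using assms by (auto simp: disjnt_def)
  ultimately obtain h where h: "continuous_map T (top_of_set {0..1::real}) h"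
      "h ` (topspace T - U) \<subseteq> {0}" "h ` K \<subseteq> {1}"
    using Urysohn_lemma[of T "topspace T - U" K 0 1] assms(1) by auto
  then have "continuous_map T euclideanreal h" "h \<in> topspace T \<rightarrow> {0..1}"
    by (simp_all add: continuous_map_in_subtopology)
  then show thesis
    using h(2,3) by (intro that[of h] below_indicatorI) auto
qed

text \<open>Lowering \<open>f\<close> by a small \<open>d\<close> and truncating at 0 costs at most
  \<open>d * L (\<lambda>x. 1)\<close>. The result vanishes off the set where \<open>f\<close> is at
  least \<open>d\<close>, which is closed, hence compact, and lies in \<open>U\<close> because
  \<open>f\<close> is 0 elsewhere.\<close>

lemma cutoff:
  assumes f: "below_indicator T U f" and e: "0 < e"
  obtains g K where "closedin T K" "K \<subseteq> U" "below_indicator T K g" "L f \<le> L g + e"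
proof -
  note fD = below_indicatorD[OF f]
  have L1: "0 \<le> L (\<lambda>x. 1)" by (rule nonneg) auto
  \<comment> \<open>The added 1 keeps the denominator positive when \<open>L\<close> vanishes on
    constants.\<close>
  define d where "d = e / (L (\<lambda>x. 1) + 1)"
  have d: "0 < d" "d * L (\<lambda>x. 1) \<le> e"
    using e L1 by (simp_all add: d_def field_simps)
  define g where "g = (\<lambda>x. max (f x - d) 0)"
  define K where "K = {x \<in> topspace T. f x \<in> {d..}}"
  have cg: "continuous_map T euclideanreal g"
    unfolding g_def by (intro continuous_intros fD(1)) auto
  show thesis
  proof
    show "closedin T K"
      unfolding K_def by (rule closedin_continuous_map_preimage[OF fD(1)]) auto
    show "K \<subseteq> U"
      using fD(4) d(1) by (force simp: K_def)
    have "g x \<le> 1" if "x \<in> topspace T" for x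
      using fD(3)[OF that] d(1) by (simp add: g_def)
    then show "below_indicator T K g"
      by (intro below_indicatorI cg) (auto simp: K_def g_def)
    have "L f \<le> L (\<lambda>x. g x + d)"
      by (rule mono[OF fD(1) continuous_map_add[OF cg]]) (auto simp: g_def)
    also have "\<dots> = L g + d * L (\<lambda>x. 1)"
      using add[OF cg, of "\<lambda>x. d"] const[of d] by simp
    finally show "L f \<le> L g + e"
      using d(2) by simp
  qed
qed

section \<open>The content of open sets and its subadditivity\<close>

definition content :: "'c set \<Rightarrow> ennreal" where
  "content U = (SUP f\<in>{f. below_indicator T U f}. ennreal (L f))"

lemma content_upper: "below_indicator T U f \<Longrightarrow> ennreal (L f) \<le> content U"
  unfolding content_def by (rule SUP_upper) simp

lemma content_least:
  "(\<And>f. below_indicator T U f \<Longrightarrow> ennreal (L f) \<le> B) \<Longrightarrow> content U \<le> B"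
  unfolding content_def by (rule SUP_least) simp

lemma content_mono: "U \<subseteq> W \<Longrightarrow> content U \<le> content W"
  by (rule content_least, rule content_upper, rule below_indicator_mono)

lemma content_topspace: "content (topspace T) = ennreal (L (\<lambda>x. 1))"
proof (rule antisym)
  show "content (topspace T) \<le> ennreal (L (\<lambda>x. 1))"
    by (intro content_least ennreal_leI mono) (auto dest: below_indicatorD)
  show "ennreal (L (\<lambda>x. 1)) \<le> content (topspace T)"
    by (intro content_upper below_indicatorI) auto
qed

lemma content_empty: "content {} = 0"
proof -
  have "L f \<le> 0" if "below_indicator T {} f" for f
    using mono[of f "\<lambda>x. 0"] below_indicatorD[OF that] zero by simp
  then have "content {} \<le> 0"
    by (intro content_least) (simp add: ennreal_neg)
  then show ?thesis by simp
qed

text \<open>A partition of unity with two members: after a cutoff to \<open>K\<close>, the closed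
  set \<open>K - W\<close> lies in \<open>U\<close>, and a Urysohn function \<open>h\<close> that is
  1 on it splits \<open>g\<close> into \<open>g * h\<close>, living on \<open>U\<close>, and
  \<open>g * (1 - h)\<close>, living on \<open>W\<close>.\<close>

lemma content_Un:
  assumes U: "openin T U" and W: "openin T W"
  shows "content (U \<union> W) \<le> content U + content W"
proof (rule content_least, rule ennreal_le_epsilon)
  fix f and e :: real
  assume f: "below_indicator T (U \<union> W) f" and e: "0 < e"
  obtain g K where K: "closedin T K" "K \<subseteq> U \<union> W" "below_indicator T K g" "L f \<le> L g + e"
    using cutoff[OF f e] .
  note gD = below_indicatorD[OF K(3)]
  have "closedin T (K - W)" "K - W \<subseteq> U"
    using K(1,2) W by (auto intro: closedin_diff)
  then obtain h where h: "below_indicator T U h" "\<And>x. x \<in> K - W \<Longrightarrow> h x = 1"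
    using Urysohn U by metis
  note hD = below_indicatorD[OF h(1)]
  have gh: "below_indicator T U (\<lambda>x. g x * h x)"
    by (intro below_indicatorI continuous_intros gD(1) hD(1)) (auto simp: gD hD mult_le_one)
  have gh': "below_indicator T W (\<lambda>x. g x * (1 - h x))"
  proof (intro below_indicatorI continuous_intros gD(1) hD(1))
    \<comment> \<open>Off \<open>W\<close>, the second factor vanishes at points of \<open>K\<close>
      and the first one at all others.\<close>
    show "g x * (1 - h x) = 0" if "x \<in> topspace T" "x \<notin> W" for x
      using that gD(4)[of x] h(2)[of x] by (cases "x \<in> K") auto
  qed (auto simp: gD hD mult_le_one)
  have "g = (\<lambda>x. g x * h x + g x * (1 - h x))"
    by (auto simp: algebra_simps)
  then have "L g = L (\<lambda>x. g x * h x) + L (\<lambda>x. g x * (1 - h x))"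
    using add[OF below_indicatorD(1)[OF gh] below_indicatorD(1)[OF gh']] by simp
  then have "ennreal (L f) \<le> ennreal (L (\<lambda>x. g x * h x) + L (\<lambda>x. g x * (1 - h x)) + e)"
    using K(4) by (intro ennreal_leI) simp
  also have "\<dots> = ennreal (L (\<lambda>x. g x * h x)) + ennreal (L (\<lambda>x. g x * (1 - h x))) + ennreal e"
    using e nonneg[OF below_indicatorD(1,2)[OF gh]] nonneg[OF below_indicatorD(1,2)[OF gh']]
    by (simp add: ennreal_plus)
  also have "\<dots> \<le> content U + content W + ennreal e"
    by (intro add_mono content_upper gh gh' order_refl)
  finally show "ennreal (L f) \<le> content U + content W + ennreal e" .
qed

lemma content_UN_lessThan:
  fixes U :: "nat \<Rightarrow> 'c set"
  assumes "\<And>i. openin T (U i)"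
  shows "content (\<Union>i<n. U i) \<le> (\<Sum>i<n. content (U i))"
proof (induction n)
  case 0
  then show ?case by (simp add: content_empty)
next
  case (Suc n)
  have "content (\<Union>i<Suc n. U i) \<le> content (U n) + content (\<Union>i<n. U i)"
    using content_Un[of "U n" "\<Union>i<n. U i"] assms by (auto simp: lessThan_Suc)
  also have "\<dots> \<le> (\<Sum>i<Suc n. content (U i))"
    using Suc by (simp add: add.commute add_right_mono)
  finally show ?case .
qed

text \<open>The cutoff moves a test function into a compact subset of the union; finitely many of
  the sets cover it, which leaves the finite case.\<close>

lemma content_UN:
  assumes U: "\<And>i::nat. openin T (U i)"
  shows "content (\<Union>i. U i) \<le> suminf (\<lambda>i. content (U i))"
proof (rule content_least, rule ennreal_le_epsilon)
  fix f and e :: real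
  assume f: "below_indicator T (\<Union>i. U i) f" and e: "0 < e"
  obtain g K where K: "closedin T K" "K \<subseteq> (\<Union>i. U i)" "below_indicator T K g" "L f \<le> L g + e"
    using cutoff[OF f e] .
  have "compactin T K"
    using K(1) compact by (rule closedin_compact_space[rotated])
  then obtain D where D: "finite D" "D \<subseteq> range U" "K \<subseteq> \<Union>D"
    using compactinD[of T K "range U"] U K(2) by auto
  obtain N where N: "finite N" "D = U ` N"
    using D(1,2) finite_subset_image by metis
  then obtain n where "N \<subseteq> {..<n}"
    using finite_nat_iff_bounded by blast
  then have "K \<subseteq> (\<Union>i<n. U i)"
    using D(3) N(2) by blast
  then have "ennreal (L g) \<le> content (\<Union>i<n. U i)"
    by (intro content_upper below_indicator_mono[OF K(3)])
  also have "\<dots> \<le> (\<Sum>i<n. content (U i))"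
    by (rule content_UN_lessThan[OF U])
  also have "\<dots> \<le> suminf (\<lambda>i. content (U i))"
    by (rule sum_le_suminf) auto
  finally have g: "ennreal (L g) \<le> suminf (\<lambda>i. content (U i))" .
  have "ennreal (L f) \<le> ennreal (L g + e)"
    using K(4) by (rule ennreal_leI)
  also have "\<dots> = ennreal (L g) + ennreal e"
    using e nonneg[OF below_indicatorD(1,2)[OF K(3)]] by simp
  also have "\<dots> \<le> suminf (\<lambda>i. content (U i)) + ennreal e"
    using g by (rule add_right_mono)
  finally show "ennreal (L f) \<le> suminf (\<lambda>i. content (U i)) + ennreal e" .
qed

section \<open>The outer measure and its measurable sets\<close>

text \<open>For \<open>E\<close> not contained in \<open>topspace T\<close> the infimum is over the
  empty family and equals infinity; hence the inclusion assumed in \<open>outer_finite\<close> and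
  \<open>outer_close\<close>.\<close>

definition outer :: "'c set \<Rightarrow> ennreal" where
  "outer E = (INF U\<in>{U. openin T U \<and> E \<subseteq> U}. content U)"

lemma outer_lower: "openin T U \<Longrightarrow> E \<subseteq> U \<Longrightarrow> outer E \<le> content U"
  unfolding outer_def by (rule INF_lower) simp

lemma outer_greatest:
  "(\<And>U. openin T U \<Longrightarrow> E \<subseteq> U \<Longrightarrow> B \<le> content U) \<Longrightarrow> B \<le> outer E"
  unfolding outer_def by (rule INF_greatest) simp

lemma outer_open: "openin T U \<Longrightarrow> outer U = content U"
  by (rule antisym[OF outer_lower outer_greatest]) (auto intro: content_mono)

lemma outer_mono: "E \<subseteq> E' \<Longrightarrow> outer E \<le> outer E'"
  by (rule outer_greatest) (rule outer_lower, auto)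

lemma outer_finite:
  assumes "E \<subseteq> topspace T"
  shows "outer E < \<infinity>"
proof -
  have "outer E \<le> ennreal (L (\<lambda>x. 1))"
    using outer_lower[OF openin_topspace assms] by (simp only: content_topspace)
  also have "\<dots> < \<infinity>" by simp
  finally show ?thesis .
qed

lemma outer_close:
  assumes "E \<subseteq> topspace T" "0 < e"
  obtains U where "openin T U" "E \<subseteq> U" "content U \<le> outer E + ennreal e"
proof -
  \<comment> \<open>Finiteness of \<open>outer E\<close> makes the inequality strict, so some open
    set comes below the right-hand side.\<close>
  have "outer E + 0 < outer E + ennreal e"
    using outer_finite[OF assms(1)] assms(2) by (subst ennreal_add_left_cancel_less) auto
  then have "(INF U\<in>{U. openin T U \<and> E \<subseteq> U}. content U) < outer E + ennreal e"
    by (simp add: outer_def)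
  then obtain U where "openin T U" "E \<subseteq> U" "content U < outer E + ennreal e"
    unfolding INF_less_iff by blast
  then show thesis
    using that less_imp_le by blast
qed

text \<open>Open supersets with errors \<open>e * (1/2) ^ Suc n\<close>, which sum to
  \<open>e\<close>, reduce this to \<open>content_UN\<close>.\<close>

lemma countably_subadditive_outer: "countably_subadditive (Pow (topspace T)) outer"
  unfolding countably_subadditive_def
proof (intro allI impI)
  fix A :: "nat \<Rightarrow> 'c set"
  assume A: "range A \<subseteq> Pow (topspace T)"
  show "outer (\<Union>i. A i) \<le> suminf (\<lambda>i. outer (A i))"
  proof (rule ennreal_le_epsilon)
    fix e :: real assume e: "0 < e"
    have "\<exists>U. openin T U \<and> A n \<subseteq> U \<and> content U \<le> outer (A n) + ennreal (e * (1/2) ^ Suc n)" for n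
    proof -
      have "A n \<subseteq> topspace T" "0 < e * (1/2) ^ Suc n"
        using A e by auto
      then show ?thesis
        using outer_close by metis
    qed
    then obtain U where U: "\<And>n. openin T (U n)" "\<And>n. A n \<subseteq> U n"
        "\<And>n. content (U n) \<le> outer (A n) + ennreal (e * (1/2) ^ Suc n)"
      by metis
    have "outer (\<Union>i. A i) \<le> content (\<Union>i. U i)"
      using U(1,2) by (intro outer_lower) blast+
    also have "\<dots> \<le> suminf (\<lambda>i. content (U i))"
      by (rule content_UN[OF U(1)])
    also have "\<dots> \<le> suminf (\<lambda>n. outer (A n) + ennreal (e * (1/2) ^ Suc n))"
      by (intro suminf_le U(3)) auto
    also have "\<dots> = suminf (\<lambda>n. outer (A n)) + suminf (\<lambda>n. ennreal e * ennreal ((1/2) ^ Suc n))"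
      using e by (subst suminf_add[symmetric])
        (auto simp del: ennreal_suminf_cmult simp add: ennreal_mult[symmetric])
    also have "\<dots> = suminf (\<lambda>n. outer (A n)) + ennreal e"
      unfolding ennreal_suminf_cmult
      by (subst suminf_ennreal_eq[OF zero_le_power power_half_series]) auto
    finally show "outer (\<Union>i. A i) \<le> suminf (\<lambda>i. outer (A i)) + ennreal e" .
  qed
qed

lemma outer_measure_space_outer: "outer_measure_space (Pow (topspace T)) outer"
  unfolding outer_measure_space_def
proof (intro conjI countably_subadditive_outer)
  show "positive (Pow (topspace T)) outer"
    by (simp add: positive_def outer_open content_empty)
  show "increasing (Pow (topspace T)) outer"
    unfolding increasing_def using outer_mono by blast
qed

text \<open>This is the hard half of Caratheodory's criterion for \<open>U\<close>, tested on an
  open set. A nearly optimal \<open>g\<close> for \<open>W \<inter> U\<close> lives on a closed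
  \<open>K\<close> inside \<open>U\<close>, and every \<open>h\<close> for \<open>W - K\<close>
  vanishes on \<open>K\<close>; so \<open>g + h\<close> stays below the indicator of
  \<open>W\<close>. Moreover \<open>W - K\<close> is an open superset of
  \<open>W - U\<close>.\<close>

lemma outer_split_open:
  assumes U: "openin T U" and W: "openin T W"
  shows "outer (W \<inter> U) + outer (W - U) \<le> content W"
proof (rule ennreal_le_epsilon)
  fix e :: real assume e: "0 < e"
  have bound: "ennreal (L f) + outer (W - U) \<le> content W + ennreal e"
    if f: "below_indicator T (W \<inter> U) f" for f
  proof -
    obtain g K where K: "closedin T K" "K \<subseteq> W \<inter> U" "below_indicator T K g" "L f \<le> L g + e"
      using cutoff[OF f e] .
    note gD = below_indicatorD[OF K(3)]
    have oWK: "openin T (W - K)"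
      using W K(1) by (rule openin_diff)
    have gh_le: "ennreal (L g) + ennreal (L h) \<le> content W"
      if h: "below_indicator T (W - K) h" for h
    proof -
      note hD = below_indicatorD[OF h]
      have gh: "below_indicator T W (\<lambda>x. g x + h x)"
      proof (intro below_indicatorI continuous_map_add gD(1) hD(1))
        show "g x + h x \<le> 1" if "x \<in> topspace T" for x
          using that gD(3,4)[of x] hD(3,4)[of x] by (cases "x \<in> K") auto
        show "g x + h x = 0" if "x \<in> topspace T" "x \<notin> W" for x
          using that gD(4)[of x] hD(4)[of x] K(2) by auto
      qed (use gD(2) hD(2) in auto)
      have "ennreal (L g) + ennreal (L h) = ennreal (L (\<lambda>x. g x + h x))"
        using add[OF gD(1) hD(1)] nonneg[OF gD(1,2)] nonneg[OF hD(1,2)] by simp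
      also have "\<dots> \<le> content W"
        by (rule content_upper[OF gh])
      finally show ?thesis .
    qed
    \<comment> \<open>The sum moves inside the supremum because the zero function makes the family
      nonempty.\<close>
    have "ennreal (L g) + content (W - K) =
        (SUP h\<in>{h. below_indicator T (W - K) h}. ennreal (L g) + ennreal (L h))"
      unfolding content_def using below_indicator_zero by (intro ennreal_SUP_add_right) blast
    also have "\<dots> \<le> content W"
      by (rule SUP_least) (simp add: gh_le)
    finally have g: "ennreal (L g) + content (W - K) \<le> content W" .
    have "ennreal (L f) \<le> ennreal (L g + e)"
      using K(4) by (rule ennreal_leI)
    also have "\<dots> = ennreal (L g) + ennreal e"
      using nonneg[OF gD(1,2)] e by simp
    finally have "ennreal (L f) + outer (W - U) \<le> ennreal (L g) + ennreal e + content (W - K)"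
      using K(2) by (intro add_mono outer_lower oWK) auto
    also have "\<dots> = ennreal (L g) + content (W - K) + ennreal e"
      by (simp add: ac_simps)
    also have "\<dots> \<le> content W + ennreal e"
      using g by (rule add_right_mono)
    finally show ?thesis .
  qed
  have "outer (W \<inter> U) + outer (W - U) = content (W \<inter> U) + outer (W - U)"
    using U W by (simp add: outer_open openin_Int)
  also have "\<dots> = (SUP f\<in>{f. below_indicator T (W \<inter> U) f}. ennreal (L f) + outer (W - U))"
    unfolding content_def using below_indicator_zero
    by (intro ennreal_SUP_add_left[symmetric]) blast
  also have "\<dots> \<le> content W + ennreal e"
    by (rule SUP_least) (simp add: bound)
  finally show "outer (W \<inter> U) + outer (W - U) \<le> content W + ennreal e" .
qed

text \<open>The lambda system consists of the Caratheodory measurable sets. One inequality is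
  subadditivity; for the other, an arbitrary test set is replaced by its open supersets, to which
  \<open>outer_split_open\<close> applies.\<close>

lemma open_in_lambda_system:
  assumes U: "openin T U"
  shows "U \<in> lambda_system (topspace T) (Pow (topspace T)) outer"
proof -
  interpret algebra "topspace T" "Pow (topspace T)"
    by (rule algebra_Pow)
  have "outer (E \<inter> U) + outer (E - U) = outer E" if E: "E \<subseteq> topspace T" for E
  proof (rule antisym)
    show "outer (E \<inter> U) + outer (E - U) \<le> outer E"
    proof (rule outer_greatest)
      fix W assume W: "openin T W" "E \<subseteq> W"
      have "outer (E \<inter> U) + outer (E - U) \<le> outer (W \<inter> U) + outer (W - U)"
        using W(2) by (intro add_mono[OF outer_mono outer_mono]) blast+
      also have "\<dots> \<le> content W"
        by (rule outer_split_open[OF U W(1)])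
      finally show "outer (E \<inter> U) + outer (E - U) \<le> content W" .
    qed
    have "subadditive (Pow (topspace T)) outer"
      using outer_measure_space_outer unfolding outer_measure_space_def
      by (blast intro: countably_subadditive_subadditive)
    then have "outer ((E \<inter> U) \<union> (E - U)) \<le> outer (E \<inter> U) + outer (E - U)"
      using E by (intro subadditiveD) auto
    then show "outer E \<le> outer (E \<inter> U) + outer (E - U)"
      by (simp add: Un_Diff_Int Int_Diff_Un)
  qed
  then show ?thesis
    using openin_subset[OF U] by (auto simp: lambda_system_eq)
qed

section \<open>The Riesz measure and its regularity\<close>

definition riesz_measure :: "'c measure" where
  "riesz_measure = measure_of (topspace T) {U. openin T U} outer"

lemma space_riesz_measure: "space riesz_measure = topspace T"
  unfolding riesz_measure_def by (rule space_measure_of) (auto dest: openin_subset)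

lemma sets_riesz_measure: "sets riesz_measure = sigma_sets (topspace T) {U. openin T U}"
  unfolding riesz_measure_def by (rule sets_measure_of) (auto dest: openin_subset)

text \<open>\<open>measure_of\<close> yields the intended values only if \<open>outer\<close> is a
  measure on the Borel sets. Caratheodory's lemma gives this on the lambda system, a sigma-algebra
  that contains the open sets and hence the Borel sets.\<close>

lemma emeasure_riesz_measure:
  assumes "B \<in> sets riesz_measure"
  shows "emeasure riesz_measure B = outer B"
proof -
  let ?B = "sigma_sets (topspace T) {U. openin T U}"
  let ?S = "lambda_system (topspace T) (Pow (topspace T)) outer"
  have "measure_space (topspace T) ?S outer"
    by (rule sigma_algebra.caratheodory_lemma[OF sigma_algebra_Pow outer_measure_space_outer])
  moreover have "?B \<subseteq> ?S"
    using calculation open_in_lambda_system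
    by (intro sigma_algebra.sigma_sets_subset) (auto simp: measure_space_def)
  ultimately have "measure_space (topspace T) ?B outer"
    by (intro measure_down[OF _ sigma_algebra_sigma_sets]) (auto dest: openin_subset)
  then have "positive (sets riesz_measure) outer" "countably_additive (sets riesz_measure) outer"
    by (simp_all add: measure_space_def sets_riesz_measure)
  then show ?thesis
    using assms by (intro emeasure_measure_of[OF riesz_measure_def]) (auto dest: openin_subset)
qed

lemma open_in_sets: "openin T U \<Longrightarrow> U \<in> sets riesz_measure"
  by (auto simp: sets_riesz_measure intro: sigma_sets.Basic)

lemma emeasure_open: "openin T U \<Longrightarrow> emeasure riesz_measure U = content U"
  using emeasure_riesz_measure[OF open_in_sets] outer_open by simp

lemma finite_measure_riesz_measure: "finite_measure riesz_measure"
  by (rule finite_measureI) (simp add: space_riesz_measure emeasure_open content_topspace)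

interpretation riesz: finite_measure riesz_measure
  by (rule finite_measure_riesz_measure)

lemma outer_regular:
  assumes "B \<in> sets riesz_measure"
  shows "emeasure riesz_measure B = (INF U\<in>{U. openin T U \<and> B \<subseteq> U}. emeasure riesz_measure U)"
  unfolding emeasure_riesz_measure[OF assms] outer_def
  by (rule INF_cong) (simp_all add: emeasure_open)

text \<open>Outer regularity of the complement: if the open \<open>U\<close> exceeds the complement
  of \<open>B\<close> by at most \<open>e\<close> in measure, then \<open>topspace T - U\<close> is
  a compact subset of \<open>B\<close> that misses at most \<open>e\<close> of it.\<close>

lemma inner_regular:
  assumes B: "B \<in> sets riesz_measure"
  shows "emeasure riesz_measure B =
    (SUP K\<in>{K. compactin T K \<and> K \<in> sets riesz_measure \<and> K \<subseteq> B}. emeasure riesz_measure K)"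
proof (rule ennreal_approx_SUP)
  show "emeasure riesz_measure K \<le> emeasure riesz_measure B"
    if "K \<in> {K. compactin T K \<and> K \<in> sets riesz_measure \<and> K \<subseteq> B}" for K
    using that B by (intro emeasure_mono) auto
next
  fix e :: real assume e: "0 < e"
  let ?C = "topspace T - B"
  have C: "?C \<in> sets riesz_measure"
    using sets.compl_sets[OF B] by (simp add: space_riesz_measure)
  obtain U where U: "openin T U" "?C \<subseteq> U" "content U \<le> outer ?C + ennreal e"
    using outer_close[OF _ e, of ?C] by blast
  define K where "K = topspace T - U"
  have Km: "K \<in> sets riesz_measure"
    using sets.compl_sets[OF open_in_sets[OF U(1)]] by (simp add: K_def space_riesz_measure)
  have "compactin T K"
    unfolding K_def using U(1) compact by (intro closedin_compact_space closedin_diff) auto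
  moreover have "K \<subseteq> B"
    using U(2) by (auto simp: K_def)
  moreover have "emeasure riesz_measure B \<le> emeasure riesz_measure K + ennreal e"
  proof -
    have "B \<subseteq> topspace T"
      using sets.sets_into_space[OF B] by (simp add: space_riesz_measure)
    then have "emeasure riesz_measure B \<le> emeasure riesz_measure (K \<union> (U - ?C))"
      using Km C open_in_sets[OF U(1)] by (intro emeasure_mono) (auto simp: K_def)
    also have "\<dots> \<le> emeasure riesz_measure K + emeasure riesz_measure (U - ?C)"
      using Km C open_in_sets[OF U(1)] by (intro emeasure_subadditive) auto
    also have "emeasure riesz_measure (U - ?C) = emeasure riesz_measure U - emeasure riesz_measure ?C"
      using C open_in_sets[OF U(1)] U(2) by (intro emeasure_Diff) auto
    also have "\<dots> \<le> ennreal e"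
      using U(3) outer_finite[of ?C]
      by (subst ennreal_minus_le_iff) (auto simp: emeasure_open[OF U(1)] emeasure_riesz_measure[OF C])
    finally show ?thesis
      by (simp add: add_left_mono)
  qed
  ultimately show "\<exists>K\<in>{K. compactin T K \<and> K \<in> sets riesz_measure \<and> K \<subseteq> B}.
      emeasure riesz_measure B \<le> emeasure riesz_measure K + ennreal e"
    using Km by blast
qed

lemma finite_regular_borel_measure_riesz: "finite_regular_borel_measure T riesz_measure"
  unfolding finite_regular_borel_measure_def
  using space_riesz_measure sets_riesz_measure finite_measure_riesz_measure
    outer_regular inner_regular by blast

section \<open>Representation by the integral\<close>

lemma integrable: "continuous_map T euclideanreal f \<Longrightarrow> integrable riesz_measure f"
  using integrable_continuous_map[OF compact] space_riesz_measure sets_riesz_measure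
    finite_measure_riesz_measure by blast

lemma le_measure:
  assumes "openin T U" "below_indicator T U f"
  shows "L f \<le> measure riesz_measure U"
  using content_upper[OF assms(2)] emeasure_open[OF assms(1)]
  by (metis riesz.emeasure_eq_measure ennreal_le_iff measure_nonneg)

lemma measure_topspace: "measure riesz_measure (topspace T) = L (\<lambda>x. 1)"
proof -
  have "ennreal (measure riesz_measure (topspace T)) = ennreal (L (\<lambda>x. 1))"
    using emeasure_open[OF openin_topspace] content_topspace riesz.emeasure_eq_measure by metis
  moreover have "0 \<le> L (\<lambda>x. 1)"
    by (rule nonneg) auto
  ultimately show ?thesis
    by simp
qed

text \<open>Slicing \<^term>\<open>f\<close> into \<^term>\<open>n\<close> layers of height \<^term>\<open>1 / n\<close> bounds \<^term>\<open>L f\<close> by a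
  Riemann sum of the layer-cake integral.\<close>

lemma le_integral_add:
  assumes f: "continuous_map T euclideanreal f" and f01: "\<And>x. x \<in> topspace T \<Longrightarrow> f x \<in> {0..1}"
    and n: "0 < n"
  shows "L f \<le> (\<integral>x. f x \<partial>riesz_measure) + L (\<lambda>x. 1) / real n"
proof -
  define c where "c = 1 / real n"
  have c: "0 < c" "real n * c = 1" using n by (simp_all add: c_def)
  \<comment> \<open>\<open>g k\<close> is the part of \<open>f\<close> between the heights
    \<open>k * c\<close> and \<open>(k + 1) * c\<close>; it vanishes off \<open>U k\<close>.\<close>
  define g where "g = (\<lambda>k x. min (max (f x - real k * c) 0) c)"
  define U where "U = (\<lambda>k. {x \<in> topspace T. f x \<in> {real k * c<..}})"
  have U: "openin T (U k)" for k
    unfolding U_def by (rule openin_continuous_map_preimage[OF f]) auto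
  have iU: "integrable riesz_measure (indicator (U k) :: _ \<Rightarrow> real)" for k
    using open_in_sets[OF U]
    by (intro integrable_real_indicator) (auto simp: riesz.emeasure_eq_measure)
  have cg: "continuous_map T euclideanreal (g k)" for k
    unfolding g_def by (intro continuous_map_real_min continuous_map_real_max continuous_map_diff f) auto
  have Lg: "L (g k) \<le> c * measure riesz_measure (U k)" for k
  proof -
    have "below_indicator T (U k) (\<lambda>x. real n * g k x)"
    proof (intro below_indicatorI continuous_map_real_mult_left cg)
      fix x
      have "real n * g k x \<le> real n * c"
        by (intro mult_left_mono) (simp_all add: g_def)
      then show "real n * g k x \<le> 1" using c by simp
    qed (use c in \<open>auto simp: g_def U_def\<close>)
    from le_measure[OF U this] have "real n * L (g k) \<le> measure riesz_measure (U k)"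
      by (simp add: scale[OF cg])
    then show ?thesis
      using n by (simp add: c_def field_simps)
  qed
  have "L f \<le> L (\<lambda>x. \<Sum>k<n. g k x)"
  proof (intro mono f continuous_map_sum cg)
    show "f x \<le> (\<Sum>k<n. g k x)" if "x \<in> topspace T" for x
      using f01[OF that] c by (simp add: g_def sum_layers)
  qed auto
  also have "\<dots> = (\<Sum>k<n. L (g k))"
    by (intro sum cg) auto
  also have "\<dots> \<le> (\<Sum>k<n. c * measure riesz_measure (U k))"
    by (intro sum_mono Lg)
  also have "\<dots> = (\<integral>x. (\<Sum>k<n. c * indicator (U k) x) \<partial>riesz_measure)"
    using open_in_sets[OF U] iU by (subst Bochner_Integration.integral_sum) auto
  also have "\<dots> \<le> (\<integral>x. f x + c \<partial>riesz_measure)"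
  proof (rule integral_mono)
    show "integrable riesz_measure (\<lambda>x. \<Sum>k<n. c * indicator (U k) x)"
      using iU by (intro Bochner_Integration.integrable_sum) auto
    show "integrable riesz_measure (\<lambda>x. f x + c)"
      using integrable[OF f] by simp
    fix x assume "x \<in> space riesz_measure"
    then have x: "f x \<in> {0..1}" "x \<in> topspace T"
      using f01 by (simp_all add: space_riesz_measure)
    \<comment> \<open>On \<open>U k\<close> the function \<open>f\<close> exceeds
      \<open>k * c\<close>, so \<open>f + c\<close> fills the k-th layer completely. The shift by
      one layer is the source of the error term.\<close>
    have "(\<Sum>k<n. c * indicator (U k) x) \<le> (\<Sum>k<n. min (max ((f x + c) - real k * c) 0) c)"
      using x c by (intro sum_mono) (auto simp: U_def indicator_def)
    also have "\<dots> \<le> f x + c"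
      using x c by (simp add: sum_layers)
    finally show "(\<Sum>k<n. c * indicator (U k) x) \<le> f x + c" .
  qed
  also have "\<dots> = (\<integral>x. f x \<partial>riesz_measure) + c * L (\<lambda>x. 1)"
    using integrable[OF f] by (simp add: space_riesz_measure measure_topspace)
  finally show ?thesis
    by (simp add: c_def)
qed

lemma le_integral:
  assumes f: "continuous_map T euclideanreal f" and f01: "\<And>x. x \<in> topspace T \<Longrightarrow> f x \<in> {0..1}"
  shows "L f \<le> (\<integral>x. f x \<partial>riesz_measure)"
proof (rule field_le_epsilon)
  fix e :: real assume e: "0 < e"
  obtain n :: nat where n: "L (\<lambda>x. 1) / e < real n"
    using reals_Archimedean2 by blast
  have "L (\<lambda>x. 1) / real (Suc n) \<le> e"
    using n e by (simp add: field_simps)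
  then show "L f \<le> (\<integral>x. f x \<partial>riesz_measure) + e"
    using le_integral_add[OF f f01, of "Suc n"] by simp
qed

text \<open>The bound of \<open>le_integral\<close> for \<open>1 - f\<close> gives the reverse
  inequality for \<open>f\<close>, since the total mass is \<open>L (\<lambda>x. 1)\<close>.\<close>

lemma eq_integral_unit:
  assumes f: "continuous_map T euclideanreal f" and f01: "\<And>x. x \<in> topspace T \<Longrightarrow> f x \<in> {0..1}"
  shows "L f = (\<integral>x. f x \<partial>riesz_measure)"
proof (rule antisym)
  show "L f \<le> (\<integral>x. f x \<partial>riesz_measure)"
    using f f01 by (rule le_integral)
  have c1: "continuous_map T euclideanreal (\<lambda>x. 1 - f x)"
    using f by (intro continuous_map_diff) auto
  have "L (\<lambda>x. 1 - f x) \<le> (\<integral>x. 1 - f x \<partial>riesz_measure)"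
    using f01 by (intro le_integral c1) auto
  moreover have "L (\<lambda>x. 1 - f x) = L (\<lambda>x. 1) - L f"
    using add[OF c1 f] by simp
  moreover have "(\<integral>x. 1 - f x \<partial>riesz_measure) = L (\<lambda>x. 1) - (\<integral>x. f x \<partial>riesz_measure)"
    using integrable[OF f] by (simp add: space_riesz_measure measure_topspace)
  ultimately show "(\<integral>x. f x \<partial>riesz_measure) \<le> L f"
    by simp
qed

text \<open>An affine change of scale brings a bounded function into the unit interval.\<close>

lemma eq_integral:
  assumes f: "continuous_map T euclideanreal f"
  shows "L f = (\<integral>x. f x \<partial>riesz_measure)"
proof -
  obtain B where B: "0 < B" "\<And>x. x \<in> topspace T \<Longrightarrow> \<bar>f x\<bar> \<le> B"
    using compact_space_continuous_map_bounded[OF compact f] by blast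
  define g where "g = (\<lambda>x. 1 / (2 * B) * (f x + B))"
  have g: "continuous_map T euclideanreal g"
    unfolding g_def using f by (intro continuous_map_real_mult_left continuous_map_add) auto
  have "g x \<in> {0..1}" if "x \<in> topspace T" for x
    using B(2)[OF that] B(1) by (auto simp: g_def field_simps abs_le_iff)
  then have "L g = (\<integral>x. g x \<partial>riesz_measure)"
    by (rule eq_integral_unit[OF g])
  moreover have "f = (\<lambda>x. 2 * B * g x + (- B))"
    using B(1) by (auto simp: g_def)
  moreover have "L (\<lambda>x. 2 * B * g x + (- B)) = 2 * B * L g - B * L (\<lambda>x. 1)"
    using add[OF continuous_map_real_mult_left[OF g], of "\<lambda>x. - B" "2 * B"] scale[OF g, of "2 * B"]
      const[of "- B"] by simp
  moreover have "(\<integral>x. 2 * B * g x + (- B) \<partial>riesz_measure) =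
      2 * B * (\<integral>x. g x \<partial>riesz_measure) - B * L (\<lambda>x. 1)"
    using integrable[OF g] by (simp add: space_riesz_measure measure_topspace)
  ultimately show ?thesis
    by metis
qed

section \<open>Uniqueness of the representing measure\<close>

text \<open>Test functions lie below the indicator of \<open>U\<close>, which bounds the content by
  the measure. Conversely, a Urysohn function fits between the indicators of a compact
  \<open>K\<close> and of \<open>U\<close>, and inner regularity passes from the sets
  \<open>K\<close> to \<open>U\<close>.\<close>

lemma emeasure_open_unique:
  assumes \<nu>: "finite_regular_borel_measure T \<nu>"
    and eq: "\<And>f. continuous_map T euclideanreal f \<Longrightarrow> L f = (\<integral>x. f x \<partial>\<nu>)"
    and U: "openin T U"
  shows "emeasure \<nu> U = content U"
proof (rule antisym)
  note D = finite_regular_borel_measureD[OF \<nu>]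
  interpret \<nu>: finite_measure \<nu> by (rule D)
  have U': "U \<in> sets \<nu>"
    using U D(2) by (auto intro: sigma_sets.Basic)
  have ind: "integrable \<nu> (indicator A :: _ \<Rightarrow> real)" if "A \<in> sets \<nu>" for A
    using that by (intro integrable_real_indicator) (auto simp: \<nu>.emeasure_eq_measure)
  show "content U \<le> emeasure \<nu> U"
  proof (rule content_least)
    fix f assume f: "below_indicator T U f"
    note fD = below_indicatorD[OF f]
    have "(\<integral>x. f x \<partial>\<nu>) \<le> (\<integral>x. indicator U x \<partial>\<nu>)"
      using fD(3,4)
      by (intro integral_mono integrable_continuous_map[OF compact fD(1) D] ind U')
        (auto simp: D(1) split: split_indicator)
    then show "ennreal (L f) \<le> emeasure \<nu> U"
      using U' eq[OF fD(1)] by (simp add: \<nu>.emeasure_eq_measure ennreal_leI)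
  qed
  have "emeasure \<nu> U = (SUP K\<in>{K. compactin T K \<and> K \<in> sets \<nu> \<and> K \<subseteq> U}. emeasure \<nu> K)"
    by (rule finite_regular_borel_measure_inner[OF \<nu> U'])
  also have "\<dots> \<le> content U"
  proof (rule SUP_least, clarify)
    fix K assume K: "compactin T K" "K \<in> sets \<nu>" "K \<subseteq> U"
    obtain h where h: "below_indicator T U h" "\<And>x. x \<in> K \<Longrightarrow> h x = 1"
      using Urysohn[OF compactin_imp_closedin[OF Hausdorff K(1)] U K(3)] by blast
    note hD = below_indicatorD[OF h(1)]
    have "(\<integral>x. indicator K x \<partial>\<nu>) \<le> (\<integral>x. h x \<partial>\<nu>)"
      using hD(2) h(2)
      by (intro integral_mono integrable_continuous_map[OF compact hD(1) D] ind K(2))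
        (auto simp: D(1) split: split_indicator)
    then have "emeasure \<nu> K \<le> ennreal (L h)"
      using K(2) eq[OF hD(1)] by (simp add: \<nu>.emeasure_eq_measure ennreal_leI)
    also have "\<dots> \<le> content U"
      by (rule content_upper[OF h(1)])
    finally show "emeasure \<nu> K \<le> content U" .
  qed
  finally show "emeasure \<nu> U \<le> content U" .
qed

theorem Riesz_representation:
  "\<exists>!\<mu>. finite_regular_borel_measure T \<mu> \<and>
     (\<forall>f. continuous_map T euclideanreal f \<longrightarrow> L f = (\<integral>x. f x \<partial>\<mu>))"
proof (rule ex1I[of _ riesz_measure])
  show "finite_regular_borel_measure T riesz_measure \<and>
      (\<forall>f. continuous_map T euclideanreal f \<longrightarrow> L f = (\<integral>x. f x \<partial>riesz_measure))"
    using finite_regular_borel_measure_riesz eq_integral by blast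
next
  fix \<nu> assume \<nu>: "finite_regular_borel_measure T \<nu> \<and>
      (\<forall>f. continuous_map T euclideanreal f \<longrightarrow> L f = (\<integral>x. f x \<partial>\<nu>))"
  show "\<nu> = riesz_measure"
  proof (rule measure_eqI)
    show "sets \<nu> = sets riesz_measure"
      using \<nu> by (simp add: finite_regular_borel_measureD(2) sets_riesz_measure)
    fix B assume B: "B \<in> sets \<nu>"
    \<comment> \<open>Outer regularity carries the agreement on open sets over to all Borel
      sets.\<close>
    have "emeasure \<nu> B = (INF U\<in>{U. openin T U \<and> B \<subseteq> U}. emeasure \<nu> U)"
      using \<nu> B by (intro finite_regular_borel_measure_outer) auto
    also have "\<dots> = outer B"
      unfolding outer_def using \<nu> by (intro INF_cong refl emeasure_open_unique) auto
    also have "\<dots> = emeasure riesz_measure B"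
      using B \<open>sets \<nu> = sets riesz_measure\<close> by (simp add: emeasure_riesz_measure)
    finally show "emeasure \<nu> B = emeasure riesz_measure B" .
  qed
qed

end

subsection \<open>Positivity on the path space\<close>


text \<open>Every point has a basic open box on which \<open>c\<close> differs from its value at the
  point by less than \<open>e / 2\<close>. Finitely many boxes cover the compact product, and each
  constrains finitely many coordinates; these make up \<open>S\<close>. Points that agree on
  \<open>S\<close> lie in a common box.\<close>

lemma product_continuous_map_nearly_finite:
  fixes c :: "('i \<Rightarrow> 'b) \<Rightarrow> real"
  assumes X: "compact_space X" and c: "continuous_map (product_topology (\<lambda>_. X) I) euclideanreal c"
    and e: "0 < e"
  obtains S where "finite S" "S \<subseteq> I"
    "\<And>x y. x \<in> I \<rightarrow>\<^sub>E topspace X \<Longrightarrow> y \<in> I \<rightarrow>\<^sub>E topspace X \<Longrightarrow> (\<And>i. i \<in> S \<Longrightarrow> x i = y i) \<Longrightarrow>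
      \<bar>c x - c y\<bar> < e"
proof -
  let ?P = "product_topology (\<lambda>_. X) I"
  have "\<forall>p\<in>topspace ?P. \<exists>U. finite {i \<in> I. U i \<noteq> topspace X} \<and> (\<forall>i\<in>I. openin X (U i)) \<and>
      p \<in> Pi\<^sub>E I U \<and> (\<forall>x\<in>Pi\<^sub>E I U. \<bar>c x - c p\<bar> < e / 2)"
  proof
    fix p assume p: "p \<in> topspace ?P"
    let ?W = "{x \<in> topspace ?P. c x \<in> ball (c p) (e / 2)}"
    have "openin ?P ?W"
      by (rule openin_continuous_map_preimage[OF c]) auto
    moreover have "p \<in> ?W"
      using p e by simp
    ultimately obtain U where "finite {i \<in> I. U i \<noteq> topspace X}" "\<forall>i\<in>I. openin X (U i)"
        "p \<in> Pi\<^sub>E I U" "Pi\<^sub>E I U \<subseteq> ?W"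
      unfolding openin_product_topology_alt by blast
    then show "\<exists>U. finite {i \<in> I. U i \<noteq> topspace X} \<and> (\<forall>i\<in>I. openin X (U i)) \<and>
        p \<in> Pi\<^sub>E I U \<and> (\<forall>x\<in>Pi\<^sub>E I U. \<bar>c x - c p\<bar> < e / 2)"
      by (intro exI[of _ U]) (auto simp: dist_real_def abs_minus_commute)
  qed
  from bchoice[OF this] obtain U where *: "\<forall>p\<in>topspace ?P. finite {i \<in> I. U p i \<noteq> topspace X} \<and>
      (\<forall>i\<in>I. openin X (U p i)) \<and> p \<in> Pi\<^sub>E I (U p) \<and> (\<forall>x\<in>Pi\<^sub>E I (U p). \<bar>c x - c p\<bar> < e / 2)"
    by (rule exE)
  have U: "finite {i \<in> I. U p i \<noteq> topspace X}" "\<And>i. i \<in> I \<Longrightarrow> openin X (U p i)"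
      "p \<in> Pi\<^sub>E I (U p)" "\<And>x. x \<in> Pi\<^sub>E I (U p) \<Longrightarrow> \<bar>c x - c p\<bar> < e / 2"
    if "p \<in> topspace ?P" for p
    using bspec[OF * that] by simp_all
  have "compactin ?P (topspace ?P)"
    unfolding compact_space_def[symmetric] using X by (simp add: compact_space_product_topology)
  moreover have "\<forall>W\<in>(\<lambda>p. Pi\<^sub>E I (U p)) ` topspace ?P. openin ?P W"
    using U(1,2) by (auto simp: openin_PiE_gen)
  moreover have "topspace ?P \<subseteq> \<Union>((\<lambda>p. Pi\<^sub>E I (U p)) ` topspace ?P)"
    using U(3) by blast
  ultimately obtain D where D: "finite D" "D \<subseteq> (\<lambda>p. Pi\<^sub>E I (U p)) ` topspace ?P" "topspace ?P \<subseteq> \<Union>D"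
    by (meson compactinD)
  then obtain N where N: "N \<subseteq> topspace ?P" "finite N" "D = (\<lambda>p. Pi\<^sub>E I (U p)) ` N"
    by (meson finite_subset_image)
  define S where "S = (\<Union>p\<in>N. {i \<in> I. U p i \<noteq> topspace X})"
  show thesis
  proof
    show "finite S" "S \<subseteq> I"
      using N(1,2) U(1) by (auto simp: S_def)
    fix x y assume x: "x \<in> I \<rightarrow>\<^sub>E topspace X" and y: "y \<in> I \<rightarrow>\<^sub>E topspace X"
      and xy: "\<And>i. i \<in> S \<Longrightarrow> x i = y i"
    obtain p where p: "p \<in> N" "x \<in> Pi\<^sub>E I (U p)"
      using x D(3) N(3) by (auto simp: subset_iff)
    have "y i \<in> U p i" if "i \<in> I" for i
    proof (cases "U p i = topspace X")
      case True
      then show ?thesis using PiE_mem[OF y that] by simp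
    next
      case False
      then have "i \<in> S" using p(1) that by (auto simp: S_def)
      then show ?thesis using xy PiE_mem[OF p(2) that] by simp
    qed
    then have "y \<in> Pi\<^sub>E I (U p)"
      using y by (auto simp: PiE_iff)
    then have "\<bar>c x - c p\<bar> < e / 2" "\<bar>c y - c p\<bar> < e / 2"
      using U(4) p N(1) by blast+
    then show "\<bar>c x - c y\<bar> < e"
      by linarith
  qed
qed

lemma mspace_cont_funs:
  assumes "compact_space T"
  shows "mspace (cont_funs T) = {f. continuous_map T euclideanreal f \<and> f \<in> extensional (topspace T)}"
  unfolding cont_funs_def compactin_mspace_cfunspace[OF assms[unfolded compact_space_def]]
  by auto

section \<open>Positivity on cylinder functions\<close>

context finite_dim_measures
begin

text \<open>The positivity of \<open>F\<close> originates here, in the nonnegativity of the measures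
  \<open>m\<close>; reindexing by ranks only inserts points of the power of \<open>X\<close> into
  \<open>a\<close>.\<close>

lemma h_star_class_nonneg:
  assumes t: "t \<in> {..<n} \<rightarrow>\<^sub>E I" and a: "a \<in> alg X n"
    and nonneg: "\<And>x. x \<in> topspace (power_top X n) \<Longrightarrow> 0 \<le> a x"
  shows "0 \<le> h_star I X m (V_class I X n t a)"
proof -
  define S where "S = t ` {..<n}"
  have fin: "finite S" and SI: "S \<subseteq> I"
    using S_def t by auto
  have sp: "space (m (card S) S) = {..<card S} \<rightarrow>\<^sub>E topspace X"
    using m[OF SI fin refl] sets_eq_imp_space_eq[of "m (card S) S" "power_sigma X \<Sigma> (card S)"]
    by (simp add: power_sigma_def space_PiM space_measure_of_conv)
  have "0 \<le> a (\<lambda>i\<in>{..<n}. x (rank_in S (t i)))" if x: "x \<in> space (m (card S) S)" for x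
  proof (rule nonneg)
    have "x (rank_in S (t i)) \<in> topspace X" if "i < n" for i
    proof -
      have "rank_in S (t i) < card S"
        using that by (intro rank_in(1)[OF fin]) (simp add: S_def)
      then show ?thesis
        using x unfolding sp by (intro PiE_mem[of x]) auto
    qed
    then show "(\<lambda>i\<in>{..<n}. x (rank_in S (t i))) \<in> topspace (power_top X n)"
      by (simp add: topspace_power_top)
  qed
  then show ?thesis
    unfolding h_star_class[OF t a S_def] by (rule Bochner_Integration.integral_nonneg)
qed

text \<open>By compactness \<^term>\<open>c\<close> depends up to \<^term>\<open>e\<close> on finitely many coordinates only;
  freezing the others at a point of \<^term>\<open>X\<close> gives a function in the image of
  \<^term>\<open>H_star I X\<close>.\<close>

lemma nonneg_approx_H_star:
  assumes X: "compact_space X" and ne: "topspace X \<noteq> {}"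
    and c: "continuous_map (path_space I X) euclideanreal c"
    and nonneg: "\<And>\<pi>. \<pi> \<in> topspace (path_space I X) \<Longrightarrow> 0 \<le> c \<pi>"
    and e: "0 < e"
  obtains v where "v \<in> sum_V I X" "0 \<le> h_star I X m v"
    "\<And>\<pi>. \<pi> \<in> topspace (path_space I X) \<Longrightarrow> \<bar>c \<pi> - H_star I X v \<pi>\<bar> < e"
proof -
  obtain S where S: "finite S" "S \<subseteq> I" and osc: "\<And>x y. x \<in> I \<rightarrow>\<^sub>E topspace X \<Longrightarrow>
      y \<in> I \<rightarrow>\<^sub>E topspace X \<Longrightarrow> (\<And>i. i \<in> S \<Longrightarrow> x i = y i) \<Longrightarrow> \<bar>c x - c y\<bar> < e"
    using product_continuous_map_nearly_finite[OF X c[unfolded path_space_def] e] by metis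
  obtain x0 where x0: "x0 \<in> topspace X"
    using ne by blast
  define n where "n = card S"
  obtain f where f: "bij_betw f S {..<n}"
    using ex_bij_betw_finite_nat[OF S(1)] by (auto simp: n_def lessThan_atLeast0)
  \<comment> \<open>\<open>t\<close> lists \<open>S\<close> in an arbitrary order;
    \<open>h_star\<close> sorts the times itself through \<open>rank_in\<close>.\<close>
  define t where "t = restrict (inv_into S f) {..<n}"
  have t: "t \<in> {..<n} \<rightarrow>\<^sub>E I"
    using bij_betw_inv_into[OF f] S(2) by (auto simp: t_def bij_betw_def)
  have tf: "t (f s) = s" "f s < n" if "s \<in> S" for s
    using f that by (auto simp: t_def bij_betw_def)
  let ?P = "path_space I X"
  \<comment> \<open>\<open>E\<close> turns an n-tuple into a path: the tuple supplies the
    coordinates in \<open>S\<close>, and all others are frozen at \<open>x0\<close>.\<close>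
  define E where "E = (\<lambda>x. \<lambda>s\<in>I. if s \<in> S then x (f s) else x0)"
  have E: "continuous_map (power_top X n) ?P E"
    unfolding E_def power_top_def path_space_def using x0 tf(2)
    by (subst continuous_map_componentwise) (auto intro!: continuous_map_product_projection)
  \<comment> \<open>Members of \<open>alg X n\<close> are extensional, hence the
    restriction.\<close>
  define a where "a = restrict (c \<circ> E) (topspace (power_top X n))"
  have "compact_space (power_top X n)"
    using X by (simp add: power_top_def compact_space_product_topology)
  then have "alg X n = {g. continuous_map (power_top X n) euclideanreal g \<and>
      g \<in> extensional (topspace (power_top X n))}"
    using mspace_cont_funs by (simp add: alg_def cont_funs_def)
  moreover have "continuous_map (power_top X n) euclideanreal a"
    unfolding a_def by (rule continuous_map_eq[OF continuous_map_compose[OF E c]]) simp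
  ultimately have a: "a \<in> alg X n"
    by (simp add: a_def)
  have Ein: "E x \<in> topspace ?P" if "x \<in> topspace (power_top X n)" for x
    using continuous_map_image_subset_topspace[OF E] that by blast
  show thesis
  proof
    show "V_class I X n t a \<in> sum_V I X"
      by (rule V_class_in_sum_V[OF t a])
    show "0 \<le> h_star I X m (V_class I X n t a)"
      using Ein nonneg by (intro h_star_class_nonneg t a) (simp add: a_def)
    fix \<pi> assume \<pi>: "\<pi> \<in> topspace ?P"
    define y where "y = (\<lambda>i\<in>{..<n}. \<pi> (t i))"
    have y: "y \<in> topspace (power_top X n)"
      using \<pi> t by (auto simp: y_def topspace_power_top path_space_def)
    have "H_star I X (V_class I X n t a) \<pi> = c (E y)"
      using H_star_class[OF t a \<pi>] y by (simp add: a_def y_def)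
    moreover have "\<bar>c \<pi> - c (E y)\<bar> < e"
    proof (rule osc)
      show "\<pi> \<in> I \<rightarrow>\<^sub>E topspace X" "E y \<in> I \<rightarrow>\<^sub>E topspace X"
        using \<pi> Ein[OF y] by (simp_all add: path_space_def)
      show "\<pi> i = E y i" if "i \<in> S" for i
        using that S(2) tf[OF that] by (auto simp: E_def y_def)
    qed
    ultimately show "\<bar>c \<pi> - H_star I X (V_class I X n t a) \<pi>\<bar> < e"
      by simp
  qed
qed

end

section \<open>From continuity and positivity to the representation of \<open>F\<close>\<close>

text \<open>Continuity for the supremum metric in epsilon-delta form, with the distance expressed by
  a pointwise bound.\<close>

lemma cont_funs_functional_close:
  assumes "compact_space T" and F: "continuous_map (mtopology_of (cont_funs T)) euclideanreal F"
    and c: "c \<in> mspace (cont_funs T)" and e: "0 < e"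
  obtains d where "0 < d" "\<And>g. g \<in> mspace (cont_funs T) \<Longrightarrow>
    (\<And>x. x \<in> topspace T \<Longrightarrow> \<bar>c x - g x\<bar> \<le> d) \<Longrightarrow> \<bar>F c - F g\<bar> < e"
proof -
  interpret Metric_space "mspace (cont_funs T)" "mdist (cont_funs T)"
    by simp
  let ?W = "{g \<in> topspace mtopology. F g \<in> ball (F c) e}"
  have "openin mtopology ?W"
    using F by (intro openin_continuous_map_preimage[of _ euclideanreal]) (auto simp: mtopology_of_def)
  moreover have "c \<in> ?W"
    using c e by simp
  ultimately obtain r where r: "0 < r" "mball c r \<subseteq> ?W"
    unfolding openin_mtopology by blast
  show thesis
  proof
    \<comment> \<open>A pointwise bound controls the supremum only non-strictly; half the radius
      keeps \<open>g\<close> in the open ball.\<close>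
    show "0 < r / 2" using r(1) by simp
    fix g assume g: "g \<in> mspace (cont_funs T)" and le: "\<And>x. x \<in> topspace T \<Longrightarrow> \<bar>c x - g x\<bar> \<le> r / 2"
    have "mdist (cont_funs T) c g \<le> r / 2"
      unfolding cont_funs_def using le r(1) by (intro mdist_cfunspace_le) (auto simp: dist_real_def)
    then have "g \<in> mball c r"
      using c g r(1) by (simp add: in_mball)
    then show "\<bar>F c - F g\<bar> < e"
      using r(2) by (auto simp: dist_real_def)
  qed
qed

text \<open>\<open>cont_funs\<close> contains extensional functions, while the locale works with
  unrestricted ones; precomposition with \<open>restrict\<close> mediates. Monotonicity is
  positivity applied to the difference.\<close>

lemma positive_functional_restrict:
  assumes T: "compact_space T" "Hausdorff_space T"
    and lin: "linear_functional_on (topspace T) (mspace (cont_funs T)) F"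
    and pos: "\<And>c. c \<in> mspace (cont_funs T) \<Longrightarrow> (\<And>x. x \<in> topspace T \<Longrightarrow> 0 \<le> c x) \<Longrightarrow> 0 \<le> F c"
  shows "positive_functional T (\<lambda>f. F (restrict f (topspace T)))"
proof -
  have rC: "restrict f (topspace T) \<in> mspace (cont_funs T)"
    if "continuous_map T euclideanreal f" for f :: "'a \<Rightarrow> real"
    unfolding mspace_cont_funs[OF T(1)] using continuous_map_eq[OF that] by auto
  have add: "F (restrict (\<lambda>x. f x + g x) (topspace T)) =
      F (restrict f (topspace T)) + F (restrict g (topspace T))"
    if "continuous_map T euclideanreal f" "continuous_map T euclideanreal g" for f g
  proof -
    have "restrict (\<lambda>x. f x + g x) (topspace T) =
        (\<lambda>x\<in>topspace T. restrict f (topspace T) x + restrict g (topspace T) x)"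
      by (rule restrict_ext) simp
    then show ?thesis
      using lin rC that by (simp only: linear_functional_on_def)
  qed
  show ?thesis
  proof
    show "F (restrict (\<lambda>x. r * f x) (topspace T)) = r * F (restrict f (topspace T))"
      if "continuous_map T euclideanreal f" for r f
    proof -
      have "restrict (\<lambda>x. r * f x) (topspace T) = (\<lambda>x\<in>topspace T. r * restrict f (topspace T) x)"
        by (rule restrict_ext) simp
      then show ?thesis
        using lin rC that by (simp only: linear_functional_on_def)
    qed
    show "F (restrict f (topspace T)) \<le> F (restrict g (topspace T))"
      if fg: "continuous_map T euclideanreal f" "continuous_map T euclideanreal g"
        and le: "\<And>x. x \<in> topspace T \<Longrightarrow> f x \<le> g x" for f g
    proof -
      have d: "continuous_map T euclideanreal (\<lambda>x. g x - f x)"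
        using fg by (intro continuous_map_diff)
      have "0 \<le> F (restrict (\<lambda>x. g x - f x) (topspace T))"
        using le by (intro pos rC d) auto
      then show ?thesis
        using add[OF d fg(1)] by simp
    qed
  qed (use T add in auto)
qed

theorem theorem6:
  fixes I :: "real set"
    and X0 :: "'a topology"
    and X :: "'b topology"
    and \<Sigma> :: "'b set set"
    and m :: "nat \<Rightarrow> real set \<Rightarrow> (nat \<Rightarrow> 'b) measure"
    and i_star F :: "((real \<Rightarrow> 'b) \<Rightarrow> real) \<Rightarrow> real"
  assumes "is_interval I" "I \<noteq> {}"
    and "topspace X0 \<noteq> {}" "locally_compact_space X0" "normal_space X0" "Hausdorff_space X0"
    and "if compact_space X0 then X homeomorphic_space X0
         else X homeomorphic_space Alexandroff_compactification X0"
    and "sigma_algebra (topspace X) \<Sigma>"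
    and "\<And>n f. continuous_map (power_top X n) euclideanreal f \<Longrightarrow>
           f \<in> borel_measurable (power_sigma X \<Sigma> n)"
    and "\<And>n S. S \<subseteq> I \<Longrightarrow> finite S \<Longrightarrow> card S = n \<Longrightarrow>
           finite_measure (m n S) \<and> sets (m n S) = sets (power_sigma X \<Sigma> n)"
    and "linear_functional_on (topspace (path_space I X)) (H_star I X ` sum_V I X) i_star"
    and "\<And>v. v \<in> sum_V I X \<Longrightarrow> i_star (H_star I X v) = h_star I X m v"
    and "linear_functional_on (topspace (path_space I X)) (mspace (cont_funs (path_space I X))) F"
    and "continuous_map (mtopology_of (cont_funs (path_space I X))) euclideanreal F"
    and "\<And>f. f \<in> H_star I X ` sum_V I X \<Longrightarrow> F f = i_star f"
  shows "\<exists>!\<mu>. finite_regular_borel_measure (path_space I X) \<mu> \<and>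
           (\<forall>c\<in>mspace (cont_funs (path_space I X)). F c = (\<integral>\<pi>. c \<pi> \<partial>\<mu>))"
proof -
  let ?P = "path_space I X"
  interpret finite_dim_measures I X \<Sigma> m
    by (rule finite_dim_measures.intro) (fact assms(8-10))+
  have "compact_space X \<and> Hausdorff_space X \<and> topspace X \<noteq> {}"
  proof (cases "compact_space X0")
    case True
    then have h: "X homeomorphic_space X0"
      using assms(7) by simp
    show ?thesis
      unfolding homeomorphic_compact_space[OF h] homeomorphic_Hausdorff_space[OF h]
      using homeomorphic_empty_space[OF h] True assms(3,6) by auto
  next
    case False
    then have h: "X homeomorphic_space Alexandroff_compactification X0"
      using assms(7) by simp
    \<comment> \<open>The point at infinity makes the compactification nonempty.\<close>
    have "Alexandroff_compactification X0 \<noteq> trivial_topology"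
      unfolding null_topspace_iff_trivial[symmetric] by simp
    then show ?thesis
      unfolding homeomorphic_compact_space[OF h] homeomorphic_Hausdorff_space[OF h]
      using homeomorphic_empty_space[OF h] assms(4,6)
      by (auto simp: Hausdorff_space_Alexandroff_compactification)
  qed
  then have X: "compact_space X" "Hausdorff_space X" "topspace X \<noteq> {}"
    by auto
  have P: "compact_space ?P" "Hausdorff_space ?P"
    using X by (simp_all add: path_space_def compact_space_product_topology Hausdorff_space_product_topology)
  have pos: "0 \<le> F c"
    if c: "c \<in> mspace (cont_funs ?P)" and c0: "\<And>\<pi>. \<pi> \<in> topspace ?P \<Longrightarrow> 0 \<le> c \<pi>" for c
  proof (rule field_le_epsilon)
    fix e :: real assume e: "0 < e"
    obtain d where d: "0 < d" "\<And>g. g \<in> mspace (cont_funs ?P) \<Longrightarrow>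
        (\<And>\<pi>. \<pi> \<in> topspace ?P \<Longrightarrow> \<bar>c \<pi> - g \<pi>\<bar> \<le> d) \<Longrightarrow> \<bar>F c - F g\<bar> < e"
      using cont_funs_functional_close[OF P(1) assms(14) c e] by metis
    have cc: "continuous_map ?P euclideanreal c"
      using c by (simp add: mspace_cont_funs[OF P(1)])
    obtain v where v: "v \<in> sum_V I X" "0 \<le> h_star I X m v"
        "\<And>\<pi>. \<pi> \<in> topspace ?P \<Longrightarrow> \<bar>c \<pi> - H_star I X v \<pi>\<bar> < d"
      by (rule nonneg_approx_H_star[OF X(1,3) cc c0 d(1)]) blast+
    \<comment> \<open>\<open>F\<close> extends \<open>i_star\<close>, so its value here is the
      nonnegative \<open>h_star I X m v\<close>.\<close>
    have "F (H_star I X v) = h_star I X m v"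
      using assms(12,15) v(1) by simp
    moreover have "\<bar>F c - F (H_star I X v)\<bar> < e"
      using v(3) by (intro d(2) H_star_in_cont_funs X(1) v(1)) (simp add: less_imp_le)
    ultimately show "0 \<le> F c + e"
      using v(2) by linarith
  qed
  interpret positive_functional ?P "\<lambda>f. F (restrict f (topspace ?P))"
    by (rule positive_functional_restrict[OF P assms(13) pos])
  \<comment> \<open>Both formulations agree because a function and its restriction have the same
    integral over a measure with space \<open>topspace ?P\<close>.\<close>
  have iff: "(\<forall>f. continuous_map ?P euclideanreal f \<longrightarrow> F (restrict f (topspace ?P)) = (\<integral>\<pi>. f \<pi> \<partial>\<mu>)) \<longleftrightarrow>
      (\<forall>c\<in>mspace (cont_funs ?P). F c = (\<integral>\<pi>. c \<pi> \<partial>\<mu>))" (is "?A \<longleftrightarrow> ?B")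
    if "finite_regular_borel_measure ?P \<mu>" for \<mu>
  proof
    assume ?A
    then show ?B
      by (auto simp: mspace_cont_funs[OF P(1)] extensional_restrict)
  next
    assume B: ?B
    show ?A
    proof (intro allI impI)
      fix f :: "(real \<Rightarrow> 'b) \<Rightarrow> real"
      assume f: "continuous_map ?P euclideanreal f"
      then have "restrict f (topspace ?P) \<in> mspace (cont_funs ?P)"
        unfolding mspace_cont_funs[OF P(1)] using continuous_map_eq[OF f] by auto
      then have "F (restrict f (topspace ?P)) = (\<integral>\<pi>. restrict f (topspace ?P) \<pi> \<partial>\<mu>)"
        using B by blast
      also have "\<dots> = (\<integral>\<pi>. f \<pi> \<partial>\<mu>)"
        using finite_regular_borel_measureD(1)[OF that] by (intro Bochner_Integration.integral_cong) auto
      finally show "F (restrict f (topspace ?P)) = (\<integral>\<pi>. f \<pi> \<partial>\<mu>)" .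
    qed
  qed
  show ?thesis
    using Riesz_representation iff by (simp cong: conj_cong)
qed

end
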